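(* Let $X$ be an effective topological space. If $X$ admits a computably admissible representation $\delta$ whose domain $\mathrm{dom}(\delta)$ is a computably overt $\Pi^0_2$-subset of $\mathbb{N}^{\mathbb{N}}$, then $X$ is an effective quasi-Polish space.
   Context: Let $(W_e)$ be a standard enumeration of c.e. sets. An effective topological space is a countably based $T_0$ space $X$ with a numbering $(B_i)_{i\in\mathbb{N}}$ of a basis such that for some computable $f$, $B_i\cap B_j=\bigcup_{k\in W_{f(i,j)}}B_k$. Effective open sets are $\bigcup_{i\in W}B_i$, $W$ c.e.; uniformly effective open means computably given indices. In $\mathbb{N}^{\mathbb{N}}$ (basis the cylinders $[\sigma]$), $\Sigma^0_2$ sets are $\bigcup_n(U_n\setminus V_n)$ with $U_n,V_n$ uniformly effective open, $\Pi^0_2$ sets are their complements, and $A$ is computably overt if $\{\sigma:[\sigma]\cap A\neq\emptyset\}$ is c.e. Let $e(x)=\{n:x\in B_n\}$ (canonical embedding into $\mathcal{P}(\omega)$) and $\rho(p)=\{n:\exists i\,p(i)=n+1\}$; the standard representation $\rho_X$ has domain $\rho^{-1}(e[X])$ and $\rho_X(p)=e^{-1}(\rho(p))$. A representation of $X$ is a partial surjection $\delta:\subseteq\mathbb{N}^{\mathbb{N}}\to X$; it is computably admissible if it is computably equivalent to $\rho_X$, i.e. there are partial computable $F,G:\subseteq\mathbb{N}^{\mathbb{N}}\to\mathbb{N}^{\mathbb{N}}$ with $\rho_X=\delta\circ F$ and $\delta=\rho_X\circ G$. $X$ is an effective quasi-Polish space if $X$ is empty or $X$ is the image of $\mathbb{N}^{\mathbb{N}}$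 under a map $f$ that is computable ($f^{-1}(B_i)$ uniformly effective open) and effectively open (there are uniformly effective open $U_\sigma\subseteq X$ with $f([\sigma])=U_\sigma$). *)

theory Defs
  imports "HOL-Analysis.Analysis" "HOL-Library.Nat_Bijection"
begin

section \<open>Computability\<close>

text \<open>
  Partial recursive functions of one argument relative to \<open>p\<close> (the program \<open>PQuery\<close> looks up
  values of \<open>p\<close>); functions of several arguments are coded through the pairing bijection \<^const>\<open>prod_encode\<close>.
\<close>

datatype prog =
    PZero | PSucc | PFst | PSnd | PQuery
  | PPair prog prog | PComp prog prog | PRec prog prog | PMin prog

inductive evals :: "(nat \<Rightarrow> nat) \<Rightarrow> prog \<Rightarrow> nat \<Rightarrow> nat \<Rightarrow> bool" for p :: "nat \<Rightarrow> nat" where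
  zero: "evals p PZero x 0"
| succ: "evals p PSucc x (Suc x)"
| fst: "evals p PFst (prod_encode (a, b)) a"
| snd: "evals p PSnd (prod_encode (a, b)) b"
| query: "evals p PQuery x (p x)"
| pair: "evals p c x y \<Longrightarrow> evals p d x z \<Longrightarrow> evals p (PPair c d) x (prod_encode (y, z))"
| comp: "evals p d x y \<Longrightarrow> evals p c y z \<Longrightarrow> evals p (PComp c d) x z"
| rec_0: "evals p c a y \<Longrightarrow> evals p (PRec c d) (prod_encode (a, 0)) y"
| rec_Suc: "evals p (PRec c d) (prod_encode (a, n)) y
    \<Longrightarrow> evals p d (prod_encode (a, prod_encode (n, y))) z
    \<Longrightarrow> evals p (PRec c d) (prod_encode (a, Suc n)) z"
| min: "evals p c (prod_encode (x, n)) 0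
    \<Longrightarrow> (\<And>m. m < n \<Longrightarrow> \<exists>y. evals p c (prod_encode (x, m)) (Suc y))
    \<Longrightarrow> evals p (PMin c) x n"

primrec goedel :: "prog \<Rightarrow> nat" where
  "goedel PZero = 0"
| "goedel PSucc = 1"
| "goedel PFst = 2"
| "goedel PSnd = 3"
| "goedel PQuery = 4"
| "goedel (PPair c d) = 5 + 4 * prod_encode (goedel c, goedel d)"
| "goedel (PComp c d) = 6 + 4 * prod_encode (goedel c, goedel d)"
| "goedel (PRec c d) = 7 + 4 * prod_encode (goedel c, goedel d)"
| "goedel (PMin c) = 8 + 4 * goedel c"

lemma inj_goedel: "goedel c = goedel d \<Longrightarrow> c = d"
proof (induction c arbitrary: d)
  case PZero then show ?case by (cases d) auto
next
  case PSucc then show ?case by (cases d) auto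
next
  case PFst then show ?case by (cases d) auto
next
  case PSnd then show ?case by (cases d) auto
next
  case PQuery then show ?case by (cases d) auto
next
  case (PPair c1 c2) then show ?case by (cases d) (auto, presburger+)
next
  case (PComp c1 c2) then show ?case by (cases d) (auto, presburger+)
next
  case (PRec c1 c2) then show ?case by (cases d) (auto, presburger+)
next
  case (PMin c) then show ?case by (cases d) (auto, presburger+)
qed

lemma surj_goedel: "\<exists>c. goedel c = n"
proof (induction n rule: less_induct)
  case (less n)
  show ?case
  proof (cases "n < 5")
    case True
    then have "n = 0 \<or> n = 1 \<or> n = 2 \<or> n = 3 \<or> n = 4" by auto
    then show ?thesis using goedel.simps(1-5) by metis
  next
    case False
    define m where "m = (n - 5) div 4"
    obtain a b where ab: "m = prod_encode (a, b)"
      by (metis prod_decode_inverse surj_pair)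
    have "m < n" using False by (simp add: m_def)
    moreover have "a \<le> m" "b \<le> m" by (simp_all add: ab le_prod_encode_1 le_prod_encode_2)
    ultimately obtain c d e where cde: "goedel c = a" "goedel d = b" "goedel e = m"
      using less.IH by (meson le_less_trans)
    have "n = 5 + 4 * m \<or> n = 6 + 4 * m \<or> n = 7 + 4 * m \<or> n = 8 + 4 * m"
      using False unfolding m_def by presburger
    then show ?thesis
      using goedel.simps(6)[of c d] goedel.simps(7)[of c d] goedel.simps(8)[of c d]
        goedel.simps(9)[of e] cde ab by metis
  qed
qed

lemma bij_goedel: "bij goedel"
  by (meson bijI injI inj_goedel surjI surj_goedel surj_def)

text \<open>
  The unrelativized notions are those relative to the constant function 0.
\<close>

definition W :: "nat \<Rightarrow> nat set" where
  "W e = {x. \<exists>c y. goedel c = e \<and> evals (\<lambda>_. 0) c x y}"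

definition ce :: "nat set \<Rightarrow> bool" where
  "ce A \<longleftrightarrow> (\<exists>e. A = W e)"

definition computable :: "(nat \<Rightarrow> nat) \<Rightarrow> bool" where
  "computable f \<longleftrightarrow> (\<exists>c. \<forall>x. evals (\<lambda>_. 0) c x (f x))"

definition computable2 :: "(nat \<Rightarrow> nat \<Rightarrow> nat) \<Rightarrow> bool" where
  "computable2 f \<longleftrightarrow> (\<exists>c. \<forall>x y. evals (\<lambda>_. 0) c (prod_encode (x, y)) (f x y))"

text \<open>
  A partial function on Baire space is computable if a single program computes \<open>F p\<close> relative to \<open>p\<close>
  for every \<open>p\<close> in the domain of \<open>F\<close>. As usual in computable analysis, nothing is required of
  the program outside this domain, so restrictions of computable functions are computable.
\<close>

definition partial_computable :: "((nat \<Rightarrow> nat) \<rightharpoonup> (nat \<Rightarrow> nat)) \<Rightarrow> bool" where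
  "partial_computable F \<longleftrightarrow> (\<exists>c. \<forall>p q. F p = Some q \<longrightarrow> (\<forall>n. evals p c n (q n)))"

section \<open>Effective open sets\<close>

definition eff_open_set :: "(nat \<Rightarrow> 'a set) \<Rightarrow> nat \<Rightarrow> 'a set" where
  "eff_open_set B e = (\<Union>i\<in>W e. B i)"

definition uniformly_eff_open :: "(nat \<Rightarrow> 'a set) \<Rightarrow> (nat \<Rightarrow> 'a set) \<Rightarrow> bool" where
  "uniformly_eff_open B U \<longleftrightarrow> (\<exists>f. computable f \<and> (\<forall>n. U n = eff_open_set B (f n)))"

definition effective_topological_space :: "'a topology \<Rightarrow> (nat \<Rightarrow> 'a set) \<Rightarrow> bool" where
  "effective_topological_space X B \<longleftrightarrow>
     t0_space X \<and>
     (\<forall>i. openin X (B i)) \<and>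
     (\<forall>U x. openin X U \<and> x \<in> U \<longrightarrow> (\<exists>i. x \<in> B i \<and> B i \<subseteq> U)) \<and>
     (\<exists>f. computable2 f \<and> (\<forall>i j. B i \<inter> B j = eff_open_set B (f i j)))"

section \<open>Subsets of Baire space\<close>

definition cylinder :: "nat list \<Rightarrow> (nat \<Rightarrow> nat) set" where
  "cylinder \<sigma> = {p. \<forall>i<length \<sigma>. p i = \<sigma> ! i}"

definition baire_basis :: "nat \<Rightarrow> (nat \<Rightarrow> nat) set" where
  "baire_basis n = cylinder (list_decode n)"

definition Sigma02 :: "(nat \<Rightarrow> nat) set \<Rightarrow> bool" where
  "Sigma02 A \<longleftrightarrow> (\<exists>U V. uniformly_eff_open baire_basis U \<and> uniformly_eff_open baire_basis V \<and>
     A = (\<Union>n. U n - V n))"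

definition Pi02 :: "(nat \<Rightarrow> nat) set \<Rightarrow> bool" where
  "Pi02 A \<longleftrightarrow> Sigma02 (- A)"

definition computably_overt :: "(nat \<Rightarrow> nat) set \<Rightarrow> bool" where
  "computably_overt A \<longleftrightarrow> ce (list_encode ` {\<sigma>. cylinder \<sigma> \<inter> A \<noteq> {}})"

section \<open>Representations\<close>

definition canonical_embedding :: "(nat \<Rightarrow> 'a set) \<Rightarrow> 'a \<Rightarrow> nat set" where
  "canonical_embedding B x = {n. x \<in> B n}"

definition enumerated_set :: "(nat \<Rightarrow> nat) \<Rightarrow> nat set" where
  "enumerated_set p = {n. \<exists>i. p i = n + 1}"

definition standard_representation ::
  "'a topology \<Rightarrow> (nat \<Rightarrow> 'a set) \<Rightarrow> (nat \<Rightarrow> nat) \<rightharpoonup> 'a" where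
  "standard_representation X B p =
     (if enumerated_set p \<in> canonical_embedding B ` topspace X
      then Some (the_inv_into (topspace X) (canonical_embedding B) (enumerated_set p))
      else None)"

definition is_representation :: "'a topology \<Rightarrow> ((nat \<Rightarrow> nat) \<rightharpoonup> 'a) \<Rightarrow> bool" where
  "is_representation X \<delta> \<longleftrightarrow> ran \<delta> = topspace X"

definition computably_admissible ::
  "'a topology \<Rightarrow> (nat \<Rightarrow> 'a set) \<Rightarrow> ((nat \<Rightarrow> nat) \<rightharpoonup> 'a) \<Rightarrow> bool" where
  "computably_admissible X B \<delta> \<longleftrightarrow>
     (\<exists>F G. partial_computable F \<and> partial_computable G \<and>
        standard_representation X B = \<delta> \<circ>\<^sub>m F \<and>
        \<delta> = standard_representation X B \<circ>\<^sub>m G)"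

section \<open>Effective quasi-Polish spaces\<close>

definition effective_quasi_Polish :: "'a topology \<Rightarrow> (nat \<Rightarrow> 'a set) \<Rightarrow> bool" where
  "effective_quasi_Polish X B \<longleftrightarrow>
     topspace X = {} \<or>
     (\<exists>f :: (nat \<Rightarrow> nat) \<Rightarrow> 'a.
        range f = topspace X \<and>
        uniformly_eff_open baire_basis (\<lambda>i. f -` B i) \<and>
        uniformly_eff_open B (\<lambda>n. f ` cylinder (list_decode n)))"

end

theory Submission
  imports Defs "HOL-Library.Sublist" "HOL-Library.More_List"
begin

text \<open>
  The domain of the standard representation \<open>\<rho>\<close> of \<open>X\<close> inherits both hypotheses on \<open>dom \<delta>\<close>. It is
  \<open>\<Pi>\<^sup>0\<^sub>2\<close>, because \<open>p\<close> belongs to it iff the translation of \<open>p\<close> to a \<open>\<delta>\<close>-name is total and lies in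
  \<open>dom \<delta>\<close>, and translating back yields an enumeration of the same set as \<open>p\<close>. It is computably
  overt, because \<open>[\<sigma>]\<close> meets it iff some \<open>\<delta>\<close>-name translates to an enumeration containing the
  indices listed by \<open>\<sigma>\<close>. A nonempty computably overt \<open>\<Pi>\<^sup>0\<^sub>2\<close> set is the image of Baire space under a
  computable, effectively open map: each input value selects, from an enumeration of the finite
  sequences that properly extend the current one, meet the set and satisfy the next open
  requirements, the one to continue with. Finally, \<open>\<rho>\<close> itself is computable and effectively open,
  since it maps \<open>[\<sigma>]\<close> onto the finite intersection of the basic open sets listed by \<open>\<sigma>\<close>.
\<close>

section \<open>Computable functions and decidable predicates\<close>

abbreviation pfst :: "nat \<Rightarrow> nat" where "pfst n \<equiv> fst (prod_decode n)"
abbreviation psnd :: "nat \<Rightarrow> nat" where "psnd n \<equiv> snd (prod_decode n)"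

lemma evals_fst: "evals p PFst x (pfst x)"
  by (metis evals.fst prod.collapse prod_decode_inverse)

lemma evals_snd: "evals p PSnd x (psnd x)"
  by (metis evals.snd prod.collapse prod_decode_inverse)

definition id_prog :: prog where "id_prog = PPair PFst PSnd"

lemma evals_id_prog: "evals p id_prog x x"
  unfolding id_prog_def using evals.pair[OF evals_fst[of p x] evals_snd[of p x]] by simp

primrec const_prog :: "nat \<Rightarrow> prog" where
  "const_prog 0 = PZero"
| "const_prog (Suc n) = PComp PSucc (const_prog n)"

lemma evals_const_prog: "evals p (const_prog n) x n"
  by (induction n) (auto intro: evals.intros)

inductive_cases evals_PCompE: "evals p (PComp c d) x z"

lemma evals_functional: "evals p c x y \<Longrightarrow> evals p c x z \<Longrightarrow> y = z"
proof (induction arbitrary: z rule: evals.induct)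
  case (comp d x y c w)
  from comp.prems show ?case by cases (use comp.IH in blast)
next
  case (pair c x y d w)
  from pair.prems show ?case by cases (use pair.IH in blast)
next
  case (rec_0 c a y d)
  from rec_0.prems show ?case by cases (use rec_0.IH in auto)
next
  case (rec_Suc c d a n y w)
  from rec_Suc.prems show ?case by cases (use rec_Suc.IH in auto)
next
  case (min c x n)
  from min.prems show ?case
  proof cases
    case min': min
    show ?thesis
    proof (rule linorder_cases[of n z])
      assume "n < z"
      then show ?thesis using min'(2) min.IH(1) by (metis nat.distinct(1))
    next
      assume "z < n"
      then show ?thesis using min'(1) min.IH(2) by (metis nat.distinct(1))
    qed
  qed
qed (auto elim: evals.cases)

named_theorems computable_intros

lemma computable_id [computable_intros]: "computable (\<lambda>x. x)"
  unfolding computable_def using evals_id_prog by blast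

lemma computable_const [computable_intros]: "computable (\<lambda>x. k)"
  unfolding computable_def using evals_const_prog by blast

lemma computable_compose: "computable f \<Longrightarrow> computable g \<Longrightarrow> computable (\<lambda>x. f (g x))"
  unfolding computable_def by (meson evals.comp)

lemma computable_fst [computable_intros]: "computable f \<Longrightarrow> computable (\<lambda>x. pfst (f x))"
  by (rule computable_compose[of pfst]) (use evals_fst computable_def in blast)

lemma computable_snd [computable_intros]: "computable f \<Longrightarrow> computable (\<lambda>x. psnd (f x))"
  by (rule computable_compose[of psnd]) (use evals_snd computable_def in blast)

lemma computable_Suc [computable_intros]: "computable f \<Longrightarrow> computable (\<lambda>x. Suc (f x))"
  by (rule computable_compose[of Suc]) (use evals.succ computable_def in blast)

lemma computable_pair [computable_intros]:
  "computable f \<Longrightarrow> computable g \<Longrightarrow> computable (\<lambda>x. prod_encode (f x, g x))"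
  unfolding computable_def by (meson evals.pair)

lemma computable2_iff: "computable2 h \<longleftrightarrow> computable (\<lambda>z. h (pfst z) (psnd z))"
  unfolding computable_def computable2_def
  by (metis prod.collapse prod_decode_inverse prod_encode_inverse fst_conv snd_conv)

lemma computable_compose2:
  assumes "computable2 h" "computable f" "computable g"
  shows "computable (\<lambda>x. h (f x) (g x))"
  using computable_compose[OF assms(1)[unfolded computable2_iff] computable_pair[OF assms(2,3)]]
  by simp

definition computable_on :: "nat set \<Rightarrow> (nat \<Rightarrow> nat) \<Rightarrow> bool" where
  "computable_on S f \<longleftrightarrow> (\<exists>c. \<forall>x\<in>S. evals (\<lambda>_. 0) c x (f x))"

lemma computable_on_UNIV: "computable_on UNIV f \<longleftrightarrow> computable f"
  by (simp add: computable_on_def computable_def)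

lemma computable_on_compose:
  assumes "computable_on S f" "computable g" "\<And>x. x \<in> T \<Longrightarrow> g x \<in> S"
  shows "computable_on T (\<lambda>x. f (g x))"
  using assms unfolding computable_on_def computable_def by (meson evals.comp)

text \<open>
  The step function of a primitive recursion only has to be computable on the states that the
  recursion can reach; this admits steps that search, and need not halt elsewhere.
\<close>

lemma computable_rec_nat_on:
  assumes "computable f" "computable k"
    and h: "computable_on {z. I (pfst z) (psnd (psnd z))}
      (\<lambda>z. h (pfst z) (pfst (psnd z)) (psnd (psnd z)))"
    and I_0: "\<And>x. I x (f x)" and I_Suc: "\<And>x n y. I x y \<Longrightarrow> I x (h x n y)"
  shows "computable (\<lambda>x. rec_nat (f x) (h x) (k x))"
proof -
  let ?o = "\<lambda>_. 0 :: nat"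
  obtain cf ck where c: "\<And>x. evals ?o cf x (f x)" "\<And>x. evals ?o ck x (k x)"
    using assms(1,2) unfolding computable_def by blast
  obtain ch where "\<And>z. I (pfst z) (psnd (psnd z)) \<Longrightarrow>
      evals ?o ch z (h (pfst z) (pfst (psnd z)) (psnd (psnd z)))"
    using h unfolding computable_on_def by blast
  from this[of "prod_encode (_, prod_encode (_, _))"]
  have step: "evals ?o ch (prod_encode (x, prod_encode (n, y))) (h x n y)" if "I x y" for x n y
    using that by simp
  have "I x (rec_nat (f x) (h x) n)" for x n
    by (induction n) (simp_all add: I_0 I_Suc)
  then have "evals ?o (PRec cf ch) (prod_encode (x, n)) (rec_nat (f x) (h x) n)" for x n
    by (induction n) (auto intro: evals.intros c step)
  then have "evals ?o (PComp (PRec cf ch) (PPair id_prog ck)) x (rec_nat (f x) (h x) (k x))" for x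
    by (rule evals.comp[OF evals.pair[OF evals_id_prog c(2)]])
  then show ?thesis unfolding computable_def by blast
qed

lemma computable_rec_nat [computable_intros]:
  assumes "computable f" "computable (\<lambda>z. h (pfst z) (pfst (psnd z)) (psnd (psnd z)))"
    and "computable k"
  shows "computable (\<lambda>x. rec_nat (f x) (h x) (k x))"
  using computable_rec_nat_on[of f k "\<lambda>_ _. True" h] assms by (simp add: computable_on_UNIV)

lemma computable_add [computable_intros]:
  assumes "computable f" "computable g" shows "computable (\<lambda>x. f x + g x)"
proof -
  have "rec_nat a (\<lambda>n y. Suc y) b = a + b" for a b :: nat by (induction b) auto
  moreover have "computable (\<lambda>x. rec_nat (f x) (\<lambda>n y. Suc y) (g x))"
    by (intro computable_intros assms)
  ultimately show ?thesis by simp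
qed

lemma computable_mult [computable_intros]:
  assumes "computable f" "computable g" shows "computable (\<lambda>x. f x * g x)"
proof -
  have "rec_nat 0 (\<lambda>n y. y + a) b = a * b" for a b :: nat by (induction b) auto
  moreover have "computable (\<lambda>x. rec_nat 0 (\<lambda>n y. y + f x) (g x))"
    by (intro computable_intros computable_compose[OF assms(1)] assms)
  ultimately show ?thesis by simp
qed

lemma computable_diff [computable_intros]:
  assumes "computable f" "computable g" shows "computable (\<lambda>x. f x - g x)"
proof -
  have "rec_nat 0 (\<lambda>n y. n) b = b - 1" for b by (cases b) auto
  moreover have "computable (\<lambda>b. rec_nat 0 (\<lambda>n y. n) b)"
    by (intro computable_intros)
  ultimately have pred: "computable (\<lambda>b. b - 1)" by simp
  have "rec_nat a (\<lambda>n y. y - 1) b = a - b" for a b :: nat by (induction b) auto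
  moreover have "computable (\<lambda>x. rec_nat (f x) (\<lambda>n y. y - 1) (g x))"
    by (intro computable_intros computable_compose[OF pred] assms)
  ultimately show ?thesis by simp
qed

definition decidable :: "(nat \<Rightarrow> bool) \<Rightarrow> bool" where
  "decidable P \<longleftrightarrow> computable (\<lambda>x. of_bool (P x))"

abbreviation decidable2 :: "(nat \<Rightarrow> nat \<Rightarrow> bool) \<Rightarrow> bool" where
  "decidable2 P \<equiv> decidable (\<lambda>z. P (pfst z) (psnd z))"

abbreviation decidable3 :: "(nat \<Rightarrow> nat \<Rightarrow> nat \<Rightarrow> bool) \<Rightarrow> bool" where
  "decidable3 P \<equiv> decidable (\<lambda>z. P (pfst z) (pfst (psnd z)) (psnd (psnd z)))"

lemma decidable_compose: "decidable P \<Longrightarrow> computable f \<Longrightarrow> decidable (\<lambda>x. P (f x))"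
  unfolding decidable_def by (rule computable_compose)

lemma decidable_compose2:
  "decidable2 P \<Longrightarrow> computable f \<Longrightarrow> computable g \<Longrightarrow> decidable (\<lambda>x. P (f x) (g x))"
  using decidable_compose[OF _ computable_pair[of f g]] by fastforce

lemma decidable_compose3:
  "decidable3 P \<Longrightarrow> computable f \<Longrightarrow> computable g \<Longrightarrow> computable h \<Longrightarrow>
    decidable (\<lambda>x. P (f x) (g x) (h x))"
  using decidable_compose[OF _ computable_pair[OF _ computable_pair, of f g h]] by fastforce

lemma decidable_const [computable_intros]: "decidable (\<lambda>x. b)"
  unfolding decidable_def by (rule computable_const)

lemma decidable_le [computable_intros]:
  assumes "computable f" "computable g" shows "decidable (\<lambda>x. f x \<le> g x)"
proof -
  have "of_bool (f x \<le> g x) = 1 - (f x - g x)" for x by simp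
  then show ?thesis unfolding decidable_def by (simp only:) (intro computable_intros assms)
qed

lemma decidable_not [computable_intros]:
  assumes "decidable P" shows "decidable (\<lambda>x. \<not> P x)"
proof -
  have "of_bool (\<not> P x) = (1 :: nat) - of_bool (P x)" for x by simp
  then show ?thesis using assms unfolding decidable_def by (simp only:) (intro computable_intros)
qed

lemma decidable_conj [computable_intros]:
  assumes "decidable P" "decidable Q" shows "decidable (\<lambda>x. P x \<and> Q x)"
  using assms unfolding decidable_def of_bool_conj by (intro computable_intros)

lemma decidable_disj [computable_intros]:
  assumes "decidable P" "decidable Q" shows "decidable (\<lambda>x. P x \<or> Q x)"
proof -
  have "decidable (\<lambda>x. \<not> (\<not> P x \<and> \<not> Q x))" by (intro computable_intros assms)
  then show ?thesis by simp
qed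

lemma decidable_less [computable_intros]:
  assumes "computable f" "computable g" shows "decidable (\<lambda>x. f x < g x)"
  unfolding less_eq_Suc_le by (intro computable_intros assms)

lemma decidable_eq [computable_intros]:
  assumes "computable f" "computable g" shows "decidable (\<lambda>x. f x = g x)"
  unfolding order.eq_iff by (intro computable_intros assms)

lemma decidable_bex [computable_intros]:
  assumes "computable f" "decidable2 P" shows "decidable (\<lambda>x. \<exists>k<f x. P x k)"
proof -
  have "rec_nat 0 (\<lambda>k y. 1 - (1 - (y + of_bool (P x k)))) n = (of_bool (\<exists>k<n. P x k) :: nat)"
    for x n
    by (induction n) (auto simp: less_Suc_eq)
  moreover have "computable (\<lambda>x. rec_nat 0 (\<lambda>k y. 1 - (1 - (y + of_bool (P x k)))) (f x))"
    using decidable_compose2[OF assms(2), of pfst "\<lambda>z. pfst (psnd z)"]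
    by (intro computable_intros assms) (simp_all add: decidable_def computable_intros)
  ultimately show ?thesis unfolding decidable_def by simp
qed

lemma decidable_ball [computable_intros]:
  assumes "computable f" "decidable2 P" shows "decidable (\<lambda>x. \<forall>k<f x. P x k)"
proof -
  have "decidable (\<lambda>x. \<not> (\<exists>k<f x. \<not> P x k))" by (intro computable_intros assms)
  then show ?thesis by simp
qed

lemma computable_if [computable_intros]:
  assumes "decidable P" "computable f" "computable g"
  shows "computable (\<lambda>x. if P x then f x else g x)"
proof -
  have "(if P x then f x else g x) = of_bool (P x) * f x + of_bool (\<not> P x) * g x" for x by simp
  then show ?thesis
    using decidable_not[OF assms(1)] assms unfolding decidable_def
    by (simp only:) (intro computable_intros)
qed

lemma evals_search:
  assumes "decidable2 R"
  obtains c where "\<And>x y. evals (\<lambda>_. 0) c x y \<longleftrightarrow> R x y \<and> (\<forall>m<y. \<not> R x m)"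
proof -
  let ?o = "\<lambda>_. 0 :: nat"
  have "computable (\<lambda>z. of_bool (\<not> R (pfst z) (psnd z)))"
    using decidable_not[OF assms] unfolding decidable_def .
  then obtain c where c: "\<And>z. evals ?o c z (of_bool (\<not> R (pfst z) (psnd z)))"
    unfolding computable_def by blast
  then have evals_c: "evals ?o c (prod_encode (x, m)) y \<longleftrightarrow> y = of_bool (\<not> R x m)" for x m y
    using evals_functional c[of "prod_encode (x, m)"] by auto
  have "evals ?o (PMin c) x y \<longleftrightarrow> R x y \<and> (\<forall>m<y. \<not> R x m)" for x y
  proof
    assume "evals ?o (PMin c) x y"
    then show "R x y \<and> (\<forall>m<y. \<not> R x m)"
      by cases (auto simp: evals_c, metis (full_types) of_bool_eq(1) nat.distinct(1))
  next
    assume "R x y \<and> (\<forall>m<y. \<not> R x m)"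
    then show "evals ?o (PMin c) x y" by (intro evals.min) (auto simp: evals_c)
  qed
  then show ?thesis by (rule that)
qed

lemma computable_on_Least:
  assumes "decidable2 R" shows "computable_on {x. \<exists>y. R x y} (\<lambda>x. LEAST y. R x y)"
proof -
  obtain c where "\<And>x y. evals (\<lambda>_. 0) c x y \<longleftrightarrow> R x y \<and> (\<forall>m<y. \<not> R x m)"
    using evals_search[OF assms] by blast
  then show ?thesis unfolding computable_on_def
    by (intro exI[of _ c]) (auto intro: LeastI dest: not_less_Least)
qed

lemma computable_if_decidable_graph:
  assumes "decidable2 (\<lambda>x y. y = f x)" shows "computable f"
  using computable_on_Least[OF assms] by (simp add: Least_equality computable_on_UNIV)

section \<open>Codes of finite sequences\<close>

definition drop_code :: "nat \<Rightarrow> nat \<Rightarrow> nat" where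
  "drop_code n c = list_encode (drop n (list_decode c))"

lemma list_decode_drop_code [simp]: "list_decode (drop_code n c) = drop n (list_decode c)"
  by (simp add: drop_code_def)

lemma prod_decode_0: "prod_decode 0 = (0, 0)"
proof -
  have "prod_encode (0, 0) = 0" by (simp add: prod_encode_def)
  then show ?thesis by (metis prod_encode_inverse)
qed

lemma list_encode_tl: "list_encode (tl (list_decode c)) = psnd (c - 1)"
  by (cases c) (auto simp: prod_decode_0 split: prod.split)

lemma nth_default_0_list_decode: "nth_default 0 (list_decode c) 0 = pfst (c - 1)"
  by (cases c) (auto simp: prod_decode_0 nth_default_def split: prod.split)

lemma computable_drop_code [computable_intros]:
  assumes "computable f" "computable g" shows "computable (\<lambda>x. drop_code (f x) (g x))"
proof -
  have "rec_nat c (\<lambda>_ y. psnd (y - 1)) n = drop_code n c" for c n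
  proof (induction n)
    case (Suc n)
    then show ?case
      using list_encode_tl[of "drop_code n c"] by (simp add: drop_code_def drop_Suc tl_drop)
  qed (simp add: drop_code_def)
  moreover have "computable (\<lambda>x. rec_nat (g x) (\<lambda>_ y. psnd (y - 1)) (f x))"
    by (intro computable_intros assms)
  ultimately show ?thesis by simp
qed

lemma computable_nth [computable_intros]:
  assumes "computable f" "computable g"
  shows "computable (\<lambda>x. nth_default 0 (list_decode (f x)) (g x))"
proof -
  have "nth_default 0 (list_decode c) n = pfst (drop_code n c - 1)" for c n
    using nth_default_0_list_decode[of "drop_code n c"]
    by (auto simp: nth_default_def split: if_splits)
  then show ?thesis by (simp only:) (intro computable_intros assms)
qed

lemma computable_length [computable_intros]:
  assumes "computable f" shows "computable (\<lambda>x. length (list_decode (f x)))"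
proof -
  have "drop_code n c = 0 \<longleftrightarrow> length (list_decode c) \<le> n" for n c
    by (metis drop_code_def drop_eq_Nil list_decode_drop_code list_decode.simps(1)
        list_encode.simps(1))
  moreover have "(\<forall>k<n. \<not> m \<le> k) \<longleftrightarrow> n \<le> m" for n m :: nat
    by (meson leI le_trans less_irrefl not_less)
  ultimately have "n = length (list_decode c) \<longleftrightarrow>
      drop_code n c = 0 \<and> (\<forall>k<n. drop_code k c \<noteq> 0)" for n c
    by auto
  then have "decidable2 (\<lambda>c n. n = length (list_decode c))"
    by (simp only:) (intro computable_intros)
  from computable_compose[OF computable_if_decidable_graph[OF this] assms] show ?thesis .
qed

lemma decidable_mem [computable_intros]:
  assumes "computable f" "computable g" shows "decidable (\<lambda>x. f x \<in> set (list_decode (g x)))"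
proof -
  have "v \<in> set l \<longleftrightarrow> (\<exists>i<length l. nth_default 0 l i = v)" for v :: nat and l
    by (auto simp: in_set_conv_nth nth_default_def)
  then show ?thesis
    by (simp only:) (intro computable_intros assms[THEN computable_compose] assms)
qed

lemma prefix_iff_nth_default:
  "prefix s t \<longleftrightarrow> length s \<le> length t \<and> (\<forall>i<length s. nth_default d s i = nth_default d t i)"
proof
  assume "prefix s t"
  then show "length s \<le> length t \<and> (\<forall>i<length s. nth_default d s i = nth_default d t i)"
    by (auto simp: prefix_def nth_default_def nth_append)
next
  assume *: "length s \<le> length t \<and> (\<forall>i<length s. nth_default d s i = nth_default d t i)"
  then have "take (length s) t = s" by (intro nth_equalityI) (auto simp: nth_default_def)
  then show "prefix s t" by (metis take_is_prefix)
qed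

lemma decidable_prefix [computable_intros]:
  assumes "computable f" "computable g"
  shows "decidable (\<lambda>x. prefix (list_decode (f x)) (list_decode (g x)))"
  unfolding prefix_iff_nth_default[where d = 0]
  by (intro computable_intros assms[THEN computable_compose] assms)

lemma computable_fold_on:
  assumes "computable f" "computable g"
    and h: "computable_on {z. I (psnd z)} (\<lambda>z. h (pfst z) (psnd z))"
    and "\<And>x. I (g x)" "\<And>v y. I y \<Longrightarrow> I (h v y)"
  shows "computable (\<lambda>x. fold h (list_decode (f x)) (g x))"
proof -
  let ?step = "\<lambda>l n. h (nth_default 0 l n)" and ?l = "\<lambda>x. list_decode (f x)"
  have "rec_nat a (?step l) n = fold h (take n l) a" if "n \<le> length l" for a l n
    using that by (induction n) (simp_all add: take_Suc_conv_app_nth nth_default_def)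
  then have "rec_nat a (?step l) (length l) = fold h l a" for a l by simp
  moreover have "computable (\<lambda>x. rec_nat (g x) (?step (?l x)) (length (?l x)))"
  proof (rule computable_rec_nat_on)
    have "computable
        (\<lambda>z. prod_encode (nth_default 0 (?l (pfst z)) (pfst (psnd z)), psnd (psnd z)))"
      by (intro computable_intros computable_compose[OF assms(1)])
    from computable_on_compose[OF h this, of "{z. I (psnd (psnd z))}"]
    show "computable_on {z. I (psnd (psnd z))}
        (\<lambda>z. ?step (?l (pfst z)) (pfst (psnd z)) (psnd (psnd z)))"
      by simp
  qed (intro computable_intros assms)+
  ultimately show ?thesis by simp
qed

section \<open>Semidecidable predicates\<close>

definition semidecidable :: "(nat \<Rightarrow> bool) \<Rightarrow> bool" where
  "semidecidable P \<longleftrightarrow> (\<exists>R. decidable2 R \<and> (\<forall>x. P x \<longleftrightarrow> (\<exists>w. R x w)))"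

abbreviation semidecidable2 :: "(nat \<Rightarrow> nat \<Rightarrow> bool) \<Rightarrow> bool" where
  "semidecidable2 P \<equiv> semidecidable (\<lambda>z. P (pfst z) (psnd z))"

abbreviation semidecidable3 :: "(nat \<Rightarrow> nat \<Rightarrow> nat \<Rightarrow> bool) \<Rightarrow> bool" where
  "semidecidable3 P \<equiv> semidecidable (\<lambda>z. P (pfst z) (pfst (psnd z)) (psnd (psnd z)))"

named_theorems semidecidable_intros

lemma semidecidableI: "decidable2 R \<Longrightarrow> (\<And>x. P x \<longleftrightarrow> (\<exists>w. R x w)) \<Longrightarrow> semidecidable P"
  unfolding semidecidable_def by blast

lemma semidecidableE:
  assumes "semidecidable P"
  obtains R where "decidable2 R" "\<And>x. P x \<longleftrightarrow> (\<exists>w. R x w)"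
  using assms unfolding semidecidable_def by blast

lemma semidecidable2E:
  assumes "semidecidable2 P"
  obtains R where "decidable3 R" "\<And>x y. P x y \<longleftrightarrow> (\<exists>w. R x y w)"
proof -
  obtain R where R: "decidable2 R" "\<And>z. P (pfst z) (psnd z) \<longleftrightarrow> (\<exists>w. R z w)"
    using semidecidableE[OF assms] by blast
  show ?thesis
  proof (rule that)
    show "decidable3 (\<lambda>x y. R (prod_encode (x, y)))"
      by (intro decidable_compose2[OF R(1)] computable_intros)
    show "P x y \<longleftrightarrow> (\<exists>w. R (prod_encode (x, y)) w)" for x y
      using R(2)[of "prod_encode (x, y)"] by simp
  qed
qed

lemma semidecidable_if_decidable: "decidable P \<Longrightarrow> semidecidable P"
  by (rule semidecidableI[of "\<lambda>x w. P x"])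
    (auto intro: decidable_compose[OF _ computable_fst[OF computable_id]])

lemma semidecidable_compose:
  assumes "semidecidable P" "computable f" shows "semidecidable (\<lambda>x. P (f x))"
proof -
  obtain R where R: "decidable2 R" "\<And>x. P x \<longleftrightarrow> (\<exists>w. R x w)"
    using semidecidableE[OF assms(1)] by blast
  have "decidable2 (\<lambda>x. R (f x))"
    by (intro decidable_compose2[OF R(1)] computable_compose[OF assms(2)] computable_intros)
  then show ?thesis using R(2) by (rule semidecidableI)
qed

lemma semidecidable_compose2:
  assumes "semidecidable2 P" "computable f" "computable g"
  shows "semidecidable (\<lambda>x. P (f x) (g x))"
  using semidecidable_compose[OF assms(1) computable_pair[OF assms(2,3)]] by simp

lemma semidecidable_compose3:
  assumes "semidecidable3 P" "computable f" "computable g" "computable h"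
  shows "semidecidable (\<lambda>x. P (f x) (g x) (h x))"
  using semidecidable_compose[OF assms(1)
      computable_pair[OF assms(2) computable_pair[OF assms(3,4)]]]
  by simp

lemma ex_prod_decode: "(\<exists>w. P (pfst w) (psnd w)) \<longleftrightarrow> (\<exists>x y. P x y)"
  by (metis prod_encode_inverse fst_conv snd_conv)

lemma semidecidable_conj [semidecidable_intros]:
  assumes "semidecidable P" "semidecidable Q" shows "semidecidable (\<lambda>x. P x \<and> Q x)"
proof -
  obtain R where R: "decidable2 R" "\<And>x. P x \<longleftrightarrow> (\<exists>w. R x w)"
    using semidecidableE[OF assms(1)] by blast
  obtain S where S: "decidable2 S" "\<And>x. Q x \<longleftrightarrow> (\<exists>w. S x w)"
    using semidecidableE[OF assms(2)] by blast
  show ?thesis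
  proof (rule semidecidableI)
    show "decidable2 (\<lambda>x w. R x (pfst w) \<and> S x (psnd w))"
      by (intro computable_intros decidable_compose2[OF R(1)] decidable_compose2[OF S(1)])
    show "P x \<and> Q x \<longleftrightarrow> (\<exists>w. R x (pfst w) \<and> S x (psnd w))" for x
      unfolding R(2) S(2) using ex_prod_decode[of "\<lambda>v w. R x v \<and> S x w"] by blast
  qed
qed

lemma semidecidable_disj [semidecidable_intros]:
  assumes "semidecidable P" "semidecidable Q" shows "semidecidable (\<lambda>x. P x \<or> Q x)"
proof -
  obtain R where R: "decidable2 R" "\<And>x. P x \<longleftrightarrow> (\<exists>w. R x w)"
    using semidecidableE[OF assms(1)] by blast
  obtain S where S: "decidable2 S" "\<And>x. Q x \<longleftrightarrow> (\<exists>w. S x w)"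
    using semidecidableE[OF assms(2)] by blast
  have "decidable2 (\<lambda>x w. R x w \<or> S x w)" by (intro computable_intros R S)
  then show ?thesis by (rule semidecidableI) (auto simp: R S)
qed

lemma semidecidable_ex [semidecidable_intros]:
  assumes "semidecidable2 P" shows "semidecidable (\<lambda>x. \<exists>y. P x y)"
proof -
  obtain R where R: "decidable3 R" "\<And>x y. P x y \<longleftrightarrow> (\<exists>w. R x y w)"
    using semidecidable2E[OF assms] by blast
  have "decidable2 (\<lambda>x w. R x (pfst w) (psnd w))"
    by (intro decidable_compose3[OF R(1)] computable_intros)
  then show ?thesis by (rule semidecidableI) (simp add: R(2) ex_prod_decode)
qed

lemma ex_list_decode: "(\<exists>c. P (list_decode c)) \<longleftrightarrow> (\<exists>s. P s)"
  by (metis list_encode_inverse)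

lemma semidecidable_ex_list [semidecidable_intros]:
  assumes "semidecidable2 (\<lambda>x c. P x (list_decode c))" shows "semidecidable (\<lambda>x. \<exists>s. P x s)"
  using semidecidable_ex[OF assms] by (simp add: ex_list_decode)

lemma ball_less_ex_iff_bounded:
  "(\<forall>k<n::nat. \<exists>w::nat. P k w) \<longleftrightarrow> (\<exists>b. \<forall>k<n. \<exists>w<b. P k w)"
proof
  assume "\<forall>k<n. \<exists>w. P k w"
  then obtain w where w: "\<And>k. k < n \<Longrightarrow> P k (w k)" by metis
  have "w k < Suc (\<Sum>j<n. w j)" if "k < n" for k
    using that by (simp add: less_Suc_eq_le member_le_sum)
  then show "\<exists>b. \<forall>k<n. \<exists>w<b. P k w" using w by blast
qed blast

lemma semidecidable_ball [semidecidable_intros]: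
  assumes "computable f" "semidecidable2 P" shows "semidecidable (\<lambda>x. \<forall>k<f x. P x k)"
proof -
  obtain R where R: "decidable3 R" "\<And>x k. P x k \<longleftrightarrow> (\<exists>w. R x k w)"
    using semidecidable2E[OF assms(2)] by blast
  have "decidable2 (\<lambda>x b. \<forall>k<f x. \<exists>w<b. R x k w)"
    by (intro computable_intros decidable_compose3[OF R(1)] computable_compose[OF assms(1)])
  then show ?thesis by (rule semidecidableI) (unfold R(2), rule ball_less_ex_iff_bounded)
qed

text \<open>
  The argument \<open>k\<close> of the enumeration is read as a guess of a witness for some \<open>P x y\<close>; a wrong
  guess is replaced by the least witness.
\<close>

lemma semidecidable_enumeration:
  assumes "semidecidable2 P"
  obtains e where "computable_on {z. \<exists>y. P (pfst z) y} e"
    "\<And>x. \<exists>y. P x y \<Longrightarrow> range (\<lambda>k. e (prod_encode (x, k))) = {y. P x y}"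
proof -
  obtain R where R: "decidable3 R" "\<And>x y. P x y \<longleftrightarrow> (\<exists>w. R x y w)"
    using semidecidable2E[OF assms] by blast
  define D where "D x w \<longleftrightarrow> R x (pfst w) (psnd w)" for x w
  have P_iff: "P x y \<longleftrightarrow> (\<exists>w. D x w \<and> pfst w = y)" for x y
    using ex_prod_decode[of "\<lambda>v w. R x v w \<and> v = y"] by (simp add: R(2) D_def)
  define pick where "pick z = (LEAST w. D (pfst z) w \<and> (\<not> D (pfst z) (psnd z) \<or> w = psnd z))" for z
  have D_pick: "D x (pick (prod_encode (x, k)))" if "\<exists>y. P x y" for x k
    using that LeastI_ex[of "\<lambda>w. D x w \<and> (\<not> D x k \<or> w = k)"] unfolding P_iff pick_def by auto
  have pick_eq: "pick (prod_encode (x, k)) = k" if "D x k" for x k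
    using that unfolding pick_def by (auto intro: Least_equality)
  show ?thesis
  proof (rule that)
    have "decidable2 (\<lambda>z w. D (pfst z) w \<and> (\<not> D (pfst z) (psnd z) \<or> w = psnd z))"
      unfolding D_def by (intro computable_intros decidable_compose3[OF R(1)])
    from computable_on_Least[OF this]
    obtain c where c: "\<And>z. \<exists>w. D (pfst z) w \<and> (\<not> D (pfst z) (psnd z) \<or> w = psnd z) \<Longrightarrow>
        evals (\<lambda>_. 0) c z (pick z)"
      unfolding computable_on_def pick_def by blast
    then have "evals (\<lambda>_. 0) c z (pick z)" if "\<exists>y. P (pfst z) y" for z
      using that unfolding P_iff by blast
    then show "computable_on {z. \<exists>y. P (pfst z) y} (\<lambda>z. pfst (pick z))"
      unfolding computable_on_def
      by (intro exI[of _ "PComp PFst c"]) (auto intro: evals.comp evals_fst)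
    show "range (\<lambda>k. pfst (pick (prod_encode (x, k)))) = {y. P x y}" if "\<exists>y. P x y" for x
    proof (intro equalityI subsetI)
      fix y assume "y \<in> {y. P x y}"
      then obtain w where "D x w" "y = pfst w" using P_iff by auto
      then show "y \<in> range (\<lambda>k. pfst (pick (prod_encode (x, k))))"
        using pick_eq[of x w] by (intro range_eqI[of _ _ w]) simp
    qed (use D_pick[OF that] P_iff in blast)
  qed
qed

section \<open>The enumeration theorem\<close>

inductive derivable :: "(nat list \<Rightarrow> nat \<Rightarrow> bool) \<Rightarrow> nat \<Rightarrow> bool" for J where
  derivable: "(\<And>u. u \<in> set D \<Longrightarrow> derivable J u) \<Longrightarrow> J D t \<Longrightarrow> derivable J t"

definition derivation :: "(nat list \<Rightarrow> nat \<Rightarrow> bool) \<Rightarrow> nat list \<Rightarrow> bool" where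
  "derivation J D \<longleftrightarrow> (\<forall>k<length D. J (drop (Suc k) D) (nth_default 0 D k))"

lemma derivation_Nil [simp]: "derivation J []"
  by (simp add: derivation_def)

lemma derivation_Cons: "derivation J (t # D) \<longleftrightarrow> J D t \<and> derivation J D"
  unfolding derivation_def length_Cons All_less_Suc2 by simp

definition monotone_rule :: "(nat list \<Rightarrow> nat \<Rightarrow> bool) \<Rightarrow> bool" where
  "monotone_rule J \<longleftrightarrow> (\<forall>D D' t. J D t \<longrightarrow> set D \<subseteq> set D' \<longrightarrow> J D' t)"

lemma derivation_append:
  assumes "monotone_rule J" "derivation J D" "derivation J E"
  shows "derivation J (D @ E)"
  using assms(2,3)
  by (induction D) (use assms(1) in \<open>auto simp: derivation_Cons monotone_rule_def\<close>)

lemma derivable_iff_derivation: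
  assumes "monotone_rule J"
  shows "derivable J t \<longleftrightarrow> (\<exists>D. derivation J D \<and> t \<in> set D)"
proof
  assume "derivable J t"
  then show "\<exists>D. derivation J D \<and> t \<in> set D"
  proof induction
    case (derivable D t)
    have "\<exists>E. derivation J E \<and> set C \<subseteq> set E" if "set C \<subseteq> set D" for C
      using that
    proof (induction C)
      case (Cons u C)
      then obtain E where "derivation J E" "set C \<subseteq> set E" by auto
      moreover obtain F where "derivation J F" "u \<in> set F"
        using derivable.IH[of u] Cons.prems by auto
      ultimately show ?case
        using derivation_append[OF assms, of E F] by (intro exI[of _ "E @ F"]) auto
    qed (auto intro: exI[of _ "[]"])
    then obtain E where "derivation J E" "set D \<subseteq> set E" by blast
    then have "derivation J (t # E)"
      using derivable.hyps assms by (auto simp: derivation_Cons monotone_rule_def)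
    then show ?case by (meson list.set_intros(1))
  qed
next
  assume "\<exists>D. derivation J D \<and> t \<in> set D"
  then obtain D where "derivation J D" "t \<in> set D" by blast
  then show "derivable J t"
    by (induction D arbitrary: t) (auto simp: derivation_Cons intro: derivable.derivable)
qed

lemma semidecidable_derivable:
  assumes J: "semidecidable3 (\<lambda>x c. J x (list_decode c))"
    and "\<And>x. monotone_rule (J x)" and "computable f"
  shows "semidecidable (\<lambda>x. derivable (J x) (f x))"
proof -
  have der: "semidecidable2 (\<lambda>x c. derivation (J x) (list_decode c))"
    unfolding derivation_def list_decode_drop_code[symmetric]
    by (intro semidecidable_intros computable_intros
        semidecidable_compose3[OF J])
  then show ?thesis
    unfolding derivable_iff_derivation[OF assms(2)]
    by (intro semidecidable_intros der semidecidable_if_decidable computable_intros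
        assms(3)[THEN computable_compose])
qed

abbreviation triple :: "nat \<Rightarrow> nat \<Rightarrow> nat \<Rightarrow> nat" where
  "triple e x y \<equiv> prod_encode (e, prod_encode (x, y))"

text \<open>
  One disjunct per rule of \<^const>\<open>evals\<close>, on codes of programs. The oracle is a relation rather than
  a function, so that finite oracle information is an oracle as well and the use principle becomes
  monotonicity in the relation.
\<close>

definition eval_rule :: "(nat \<Rightarrow> nat \<Rightarrow> bool) \<Rightarrow> nat list \<Rightarrow> nat \<Rightarrow> bool" where
  "eval_rule Q D t \<longleftrightarrow> (let e = pfst t; x = pfst (psnd t); y = psnd (psnd t) in
     (e = 0 \<and> y = 0 \<or>
      e = 1 \<and> y = Suc x \<or>
      e = 2 \<and> (\<exists>b. x = prod_encode (y, b)) \<or>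
      e = 3 \<and> (\<exists>a. x = prod_encode (a, y)) \<or>
      e = 4 \<and> Q x y \<or>
      (\<exists>c d a b. e = 5 + 4 * prod_encode (c, d) \<and> y = prod_encode (a, b) \<and>
         triple c x a \<in> set D \<and> triple d x b \<in> set D) \<or>
      (\<exists>c d z. e = 6 + 4 * prod_encode (c, d) \<and> triple d x z \<in> set D \<and> triple c z y \<in> set D) \<or>
      (\<exists>c d a. e = 7 + 4 * prod_encode (c, d) \<and> x = prod_encode (a, 0) \<and> triple c a y \<in> set D) \<or>
      (\<exists>c d a n z. e = 7 + 4 * prod_encode (c, d) \<and> x = prod_encode (a, Suc n) \<and>
         triple e (prod_encode (a, n)) z \<in> set D \<and> triple d (triple a n z) y \<in> set D) \<or>
      (\<exists>c. e = 8 + 4 * c \<and> triple c (prod_encode (x, y)) 0 \<in> set D \<and>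
         (\<forall>m<y. \<exists>z. triple c (prod_encode (x, m)) (Suc z) \<in> set D))))"

lemma eval_rule_mono:
  assumes "eval_rule Q D t" "\<And>u v. Q u v \<Longrightarrow> Q' u v" "set D \<subseteq> set D'"
  shows "eval_rule Q' D' t"
  using assms(1) unfolding eval_rule_def Let_def
  by (elim ex_forward conj_forward disj_forward all_forward imp_forward) (use assms(2,3) in auto)

lemma monotone_rule_eval_rule: "monotone_rule (eval_rule Q)"
  unfolding monotone_rule_def using eval_rule_mono by blast

lemma semidecidable_eval_rule:
  assumes Q: "semidecidable3 Q"
  shows "semidecidable3 (\<lambda>x c. eval_rule (Q x) (list_decode c))"
  unfolding eval_rule_def Let_def
  by (intro semidecidable_intros semidecidable_compose3[OF Q] semidecidable_if_decidable
      computable_intros)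

definition prog_of :: "nat \<Rightarrow> prog" where "prog_of = inv goedel"

lemma prog_of_goedel [simp]: "prog_of (goedel c) = c"
  by (simp add: prog_of_def bij_goedel bij_is_inj)

lemma goedel_prog_of [simp]: "goedel (prog_of e) = e"
  by (simp add: prog_of_def surj_f_inv_f bij_goedel bij_is_surj)

lemma prog_of_simps:
  "prog_of 0 = PZero" "prog_of (Suc 0) = PSucc" "prog_of 2 = PFst" "prog_of 3 = PSnd"
  "prog_of 4 = PQuery"
  "prog_of (5 + 4 * prod_encode (c, d)) = PPair (prog_of c) (prog_of d)"
  "prog_of (6 + 4 * prod_encode (c, d)) = PComp (prog_of c) (prog_of d)"
  "prog_of (7 + 4 * prod_encode (c, d)) = PRec (prog_of c) (prog_of d)"
  "prog_of (8 + 4 * c) = PMin (prog_of c)"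
  by (rule inj_goedel, simp)+

lemma eval_rule_sound:
  assumes D: "\<And>e x y. triple e x y \<in> set D \<Longrightarrow> evals p (prog_of e) x y"
    and "eval_rule (\<lambda>u v. v = p u) D (triple e x y)"
  shows "evals p (prog_of e) x y"
  using assms(2) unfolding eval_rule_def Let_def
  by (auto simp: prog_of_simps intro: evals.intros dest!: D) (rule evals.min; blast intro: D)

lemma evals_if_derivable:
  "derivable (eval_rule (\<lambda>u v. v = p u)) (triple e x y) \<Longrightarrow> evals p (prog_of e) x y"
  by (induction "triple e x y" arbitrary: e x y rule: derivable.induct)
    (blast intro: eval_rule_sound)

lemma
  shows eval_rule_zero: "eval_rule Q D (triple (goedel PZero) x 0)"
    and eval_rule_succ: "eval_rule Q D (triple (goedel PSucc) x (Suc x))"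
    and eval_rule_fst: "eval_rule Q D (triple (goedel PFst) (prod_encode (a, b)) a)"
    and eval_rule_snd: "eval_rule Q D (triple (goedel PSnd) (prod_encode (a, b)) b)"
    and eval_rule_query: "Q x y \<Longrightarrow> eval_rule Q D (triple (goedel PQuery) x y)"
    and eval_rule_pair: "triple (goedel c) x y \<in> set D \<Longrightarrow> triple (goedel d) x z \<in> set D \<Longrightarrow>
      eval_rule Q D (triple (goedel (PPair c d)) x (prod_encode (y, z)))"
  unfolding eval_rule_def by simp_all

lemma
  shows eval_rule_comp: "triple (goedel d) x y \<in> set D \<Longrightarrow> triple (goedel c) y z \<in> set D \<Longrightarrow>
      eval_rule Q D (triple (goedel (PComp c d)) x z)"
    and eval_rule_rec_0: "triple (goedel c) a y \<in> set D \<Longrightarrow>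
      eval_rule Q D (triple (goedel (PRec c d)) (prod_encode (a, 0)) y)"
    and eval_rule_rec_Suc: "triple (goedel (PRec c d)) (prod_encode (a, n)) y \<in> set D \<Longrightarrow>
      triple (goedel d) (triple a n y) z \<in> set D \<Longrightarrow>
      eval_rule Q D (triple (goedel (PRec c d)) (prod_encode (a, Suc n)) z)"
    and eval_rule_min: "triple (goedel c) (prod_encode (x, n)) 0 \<in> set D \<Longrightarrow>
      \<forall>m<n. \<exists>z. triple (goedel c) (prod_encode (x, m)) (Suc z) \<in> set D \<Longrightarrow>
      eval_rule Q D (triple (goedel (PMin c)) x n)"
  unfolding eval_rule_def Let_def prod_encode_inverse fst_conv snd_conv goedel.simps by blast+

lemma derivable_if_evals:
  fixes p :: "nat \<Rightarrow> nat"
  defines "Q \<equiv> \<lambda>u v. v = p u"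
  assumes "evals p c x y"
  shows "derivable (eval_rule Q) (triple (goedel c) x y)"
  using assms(2)
proof (induction rule: evals.induct)
  case (pair c x y d z)
  show ?case
    by (rule derivable.intros[of "[triple (goedel c) x y, triple (goedel d) x z]" "eval_rule Q",
          OF _ eval_rule_pair])
      (use pair.IH in auto)
next
  case (comp d x y c z)
  show ?case
    by (rule derivable.intros[of "[triple (goedel d) x y, triple (goedel c) y z]" "eval_rule Q",
          OF _ eval_rule_comp])
      (use comp.IH in auto)
next
  case (rec_0 c a y d)
  show ?case
    by (rule derivable.intros[of "[triple (goedel c) a y]" "eval_rule Q", OF _ eval_rule_rec_0])
      (use rec_0.IH in auto)
next
  case (rec_Suc c d a n y z)
  let ?D = "[triple (goedel (PRec c d)) (prod_encode (a, n)) y, triple (goedel d) (triple a n y) z]"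
  show ?case
    by (rule derivable.intros[of ?D "eval_rule Q", OF _ eval_rule_rec_Suc])
      (use rec_Suc.IH in auto)
next
  case (min c x n)
  from min.IH(2) obtain z where z: "\<And>m. m < n \<Longrightarrow>
      derivable (eval_rule Q) (triple (goedel c) (prod_encode (x, m)) (Suc (z m)))"
    by metis
  let ?D = "triple (goedel c) (prod_encode (x, n)) 0 #
    map (\<lambda>m. triple (goedel c) (prod_encode (x, m)) (Suc (z m))) [0..<n]"
  show ?case
    by (rule derivable.intros[of ?D "eval_rule Q", OF _ eval_rule_min])
      (use min.IH(1) z in \<open>auto simp: image_iff\<close>)
qed (rule derivable.intros[of "[]" "eval_rule Q"], simp, intro eval_rule_zero eval_rule_succ
    eval_rule_fst eval_rule_snd eval_rule_query; simp add: Q_def)+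

lemma evals_iff_derivable:
  "evals p c x y \<longleftrightarrow> derivable (eval_rule (\<lambda>u v. v = p u)) (triple (goedel c) x y)"
  using derivable_if_evals evals_if_derivable by (metis prog_of_goedel)

lemma mem_W_iff: "x \<in> W e \<longleftrightarrow> (\<exists>y. evals (\<lambda>_. 0) (prog_of e) x y)"
  unfolding W_def by (auto intro: exI[of _ "prog_of e"])

lemma semidecidable_mem_W:
  assumes "computable f" "computable g" shows "semidecidable (\<lambda>x. f x \<in> W (g x))"
  unfolding mem_W_iff evals_iff_derivable goedel_prog_of
  by (intro semidecidable_intros monotone_rule_eval_rule computable_intros
      semidecidable_if_decidable semidecidable_derivable[where J = "\<lambda>_. eval_rule (\<lambda>u v. v = 0)"]
      semidecidable_eval_rule[where Q = "\<lambda>_ u v. v = 0"] assms[THEN computable_compose])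

lemma semidecidable_halting:
  assumes "semidecidable P"
  obtains c where "\<And>x. (\<exists>y. evals (\<lambda>_. 0) c x y) \<longleftrightarrow> P x"
proof -
  obtain R where R: "decidable2 R" "\<And>x. P x \<longleftrightarrow> (\<exists>w. R x w)"
    using semidecidableE[OF assms] by blast
  obtain c where c: "\<And>x y. evals (\<lambda>_. 0) c x y \<longleftrightarrow> R x y \<and> (\<forall>m<y. \<not> R x m)"
    using evals_search[OF R(1)] by blast
  show ?thesis
    by (rule that[of c]) (simp add: c R(2) exists_least_iff[of "R _"])
qed

lemma computable_goedel_const_prog: "computable (\<lambda>n. goedel (const_prog n))"
proof -
  have "goedel (const_prog n) = rec_nat 0 (\<lambda>k y. 6 + 4 * prod_encode (1, y)) n" for n
    by (induction n) auto
  then show ?thesis by (simp only:) (intro computable_intros)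
qed

text \<open>An instance of the s-m-n theorem: \<open>n\<close> is hard-wired into a program for \<open>P\<close>.\<close>

lemma semidecidable_W_index:
  assumes "semidecidable2 P"
  obtains f where "computable f" "\<And>n. W (f n) = {x. P n x}"
proof -
  let ?o = "\<lambda>_. 0 :: nat"
  obtain c where c: "\<And>z. (\<exists>y. evals ?o c z y) \<longleftrightarrow> P (pfst z) (psnd z)"
    using semidecidable_halting[OF assms] by blast
  define d where "d n = PPair (const_prog n) id_prog" for n
  have d: "evals ?o (d n) x z \<longleftrightarrow> z = prod_encode (n, x)" for n x z
    unfolding d_def using evals_functional evals.pair[OF evals_const_prog evals_id_prog] by blast
  have "computable (\<lambda>n. goedel (PComp c (d n)))"
    unfolding d_def goedel.simps by (intro computable_intros computable_goedel_const_prog)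
  moreover have "W (goedel (PComp c (d n))) = {x. P n x}" for n
  proof -
    have "(\<exists>y. evals ?o (PComp c (d n)) x y) \<longleftrightarrow> (\<exists>y. evals ?o c (prod_encode (n, x)) y)" for x
      by (metis d evals.comp evals_PCompE)
    then show ?thesis by (auto simp: mem_W_iff c simp del: goedel.simps)
  qed
  ultimately show ?thesis by (rule that)
qed

lemma ce_iff_semidecidable: "ce A \<longleftrightarrow> semidecidable (\<lambda>x. x \<in> A)"
proof
  assume "ce A"
  then show "semidecidable (\<lambda>x. x \<in> A)"
    unfolding ce_def by (auto intro: semidecidable_mem_W computable_intros)
next
  assume "semidecidable (\<lambda>x. x \<in> A)"
  then have "semidecidable2 (\<lambda>_ x. x \<in> A)" by (rule semidecidable_compose) (intro computable_intros)
  then show "ce A" unfolding ce_def by (rule semidecidable_W_index) auto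
qed

lemma uniformly_eff_openI:
  assumes "semidecidable2 P" "\<And>n. U n = (\<Union>i\<in>{i. P n i}. B i)"
  shows "uniformly_eff_open B U"
  using semidecidable_W_index[OF assms(1)] assms(2)
  unfolding uniformly_eff_open_def eff_open_set_def by metis

lemma uniformly_eff_openE:
  assumes "uniformly_eff_open B U"
  obtains P where "semidecidable2 P" "\<And>n. U n = (\<Union>i\<in>{i. P n i}. B i)"
proof -
  obtain f where f: "computable f" "\<And>n. U n = (\<Union>i\<in>W (f n). B i)"
    using assms unfolding uniformly_eff_open_def eff_open_set_def by blast
  have "semidecidable2 (\<lambda>n i. i \<in> W (f n))"
    by (intro semidecidable_mem_W computable_intros computable_compose[OF f(1)])
  then show ?thesis by (rule that) (simp add: f(2))
qed

lemma uniformly_eff_open_UN: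
  assumes "uniformly_eff_open B V" "semidecidable2 P"
  shows "uniformly_eff_open B (\<lambda>n. \<Union>k\<in>{k. P n k}. V k)"
proof -
  obtain Q where Q: "semidecidable2 Q" "\<And>k. V k = (\<Union>i\<in>{i. Q k i}. B i)"
    using uniformly_eff_openE[OF assms(1)] by blast
  have "semidecidable2 (\<lambda>n i. \<exists>k. P n k \<and> Q k i)"
    by (intro semidecidable_intros semidecidable_compose2[OF assms(2)]
        semidecidable_compose2[OF Q(1)] computable_intros)
  then show ?thesis by (rule uniformly_eff_openI) (auto simp: Q(2))
qed

section \<open>Predicates semidecidable in an oracle\<close>

definition initial :: "(nat \<Rightarrow> nat) \<Rightarrow> nat \<Rightarrow> nat list" where
  "initial p m = map p [0..<m]"

lemma length_initial [simp]: "length (initial p m) = m"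
  by (simp add: initial_def)

lemma nth_initial [simp]: "i < m \<Longrightarrow> initial p m ! i = p i"
  by (simp add: initial_def)

lemma initial_Suc: "initial p (Suc m) = initial p m @ [p m]"
  by (simp add: initial_def)

lemma mem_cylinder_iff_initial: "p \<in> cylinder s \<longleftrightarrow> initial p (length s) = s"
  unfolding cylinder_def by (auto simp: list_eq_iff_nth_eq)

lemma mem_cylinder_initial [simp]: "p \<in> cylinder (initial p m)"
  by (simp add: mem_cylinder_iff_initial)

lemma cylinder_Nil [simp]: "cylinder [] = UNIV"
  by (simp add: cylinder_def)

lemma cylinder_antimono: "prefix s t \<Longrightarrow> cylinder t \<subseteq> cylinder s"
  by (auto simp: cylinder_def prefix_def nth_append)

lemma prefix_initial: "m \<le> n \<Longrightarrow> prefix (initial p m) (initial p n)"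
  by (simp add: prefix_iff_nth_default[where d = 0] nth_default_def)

lemma prefix_initial_iff: "prefix s (initial p m) \<longleftrightarrow> length s \<le> m \<and> p \<in> cylinder s"
  by (auto simp: prefix_iff_nth_default[where d = 0] nth_default_def cylinder_def)

lemma ex_mem_cylinder_iff: "(\<exists>s. p \<in> cylinder s \<and> P s) \<longleftrightarrow> (\<exists>m. P (initial p m))"
  by (metis mem_cylinder_iff_initial mem_cylinder_initial)

definition extension_closed :: "(nat list \<Rightarrow> bool) \<Rightarrow> bool" where
  "extension_closed P \<longleftrightarrow> (\<forall>s t. P s \<longrightarrow> prefix s t \<longrightarrow> P t)"

lemma eventually_initial_iff:
  assumes "extension_closed P"
  shows "(\<forall>\<^sub>F m in sequentially. P (initial p m)) \<longleftrightarrow> (\<exists>m. P (initial p m))"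
  using assms prefix_initial unfolding extension_closed_def eventually_sequentially
  by (metis order_refl)

definition oracle_semidecidable :: "((nat \<Rightarrow> nat) \<Rightarrow> nat \<Rightarrow> bool) \<Rightarrow> bool" where
  "oracle_semidecidable \<phi> \<longleftrightarrow> uniformly_eff_open baire_basis (\<lambda>n. {p. \<phi> p n})"

named_theorems oracle_semidecidable_intros

lemma oracle_semidecidableI:
  assumes "semidecidable2 (\<lambda>n c. P n (list_decode c))"
    and "\<And>p n. \<phi> p n \<longleftrightarrow> (\<exists>m. P n (initial p m))"
  shows "oracle_semidecidable \<phi>"
  unfolding oracle_semidecidable_def
proof (rule uniformly_eff_openI[OF assms(1)])
  have "\<phi> p n \<longleftrightarrow> (\<exists>c. p \<in> cylinder (list_decode c) \<and> P n (list_decode c))" for p n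
    using ex_list_decode[of "\<lambda>s. p \<in> cylinder s \<and> P n s"]
    by (simp add: assms(2) ex_mem_cylinder_iff)
  then show "{p. \<phi> p n} = (\<Union>i\<in>{i. P n (list_decode i)}. baire_basis i)" for n
    by (auto simp: baire_basis_def)
qed

lemma oracle_semidecidableE:
  assumes "oracle_semidecidable \<phi>"
  obtains P where "semidecidable2 (\<lambda>n c. P n (list_decode c))" "\<And>n. extension_closed (P n)"
    "\<And>p n. \<phi> p n \<longleftrightarrow> (\<exists>m. P n (initial p m))"
proof -
  obtain Q where Q: "semidecidable2 Q" "\<And>n. {p. \<phi> p n} = (\<Union>i\<in>{i. Q n i}. baire_basis i)"
    using assms unfolding oracle_semidecidable_def by (rule uniformly_eff_openE) blast
  define P where "P n s \<longleftrightarrow> (\<exists>c. Q n c \<and> prefix (list_decode c) s)" for n s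
  show ?thesis
  proof (rule that)
    show "semidecidable2 (\<lambda>n c. P n (list_decode c))"
      unfolding P_def
      by (intro semidecidable_intros semidecidable_compose2[OF Q(1)] semidecidable_if_decidable
          computable_intros)
    show "extension_closed (P n)" for n
      unfolding extension_closed_def P_def using prefix_order.trans by blast
    have "\<phi> p n \<longleftrightarrow> (\<exists>c. Q n c \<and> p \<in> cylinder (list_decode c))" for p n
      using Q(2) by (auto simp: baire_basis_def set_eq_iff)
    then show "\<phi> p n \<longleftrightarrow> (\<exists>m. P n (initial p m))" for p n
      unfolding P_def prefix_initial_iff by blast
  qed
qed

lemma oracle_semidecidable_if_semidecidable:
  assumes "semidecidable P" shows "oracle_semidecidable (\<lambda>_. P)"
  by (rule oracle_semidecidableI[of "\<lambda>n _. P n"])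
    (use semidecidable_compose[OF assms computable_fst[OF computable_id]] in auto)

lemma oracle_semidecidable_compose:
  assumes "oracle_semidecidable \<phi>" "computable f"
  shows "oracle_semidecidable (\<lambda>p n. \<phi> p (f n))"
proof -
  obtain P where P: "semidecidable2 (\<lambda>n c. P n (list_decode c))"
    "\<And>p n. \<phi> p n \<longleftrightarrow> (\<exists>m. P n (initial p m))"
    using oracle_semidecidableE[OF assms(1)] by metis
  have "semidecidable2 (\<lambda>n c. P (f n) (list_decode c))"
    by (intro semidecidable_compose2[OF P(1)] computable_compose[OF assms(2)] computable_intros)
  then show ?thesis by (rule oracle_semidecidableI) (simp add: P(2))
qed

lemma oracle_semidecidable_conj [oracle_semidecidable_intros]:
  assumes "oracle_semidecidable \<phi>" "oracle_semidecidable \<psi>"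
  shows "oracle_semidecidable (\<lambda>p n. \<phi> p n \<and> \<psi> p n)"
proof -
  obtain P where P: "semidecidable2 (\<lambda>n c. P n (list_decode c))" "\<And>n. extension_closed (P n)"
    "\<And>p n. \<phi> p n \<longleftrightarrow> (\<exists>m. P n (initial p m))"
    using oracle_semidecidableE[OF assms(1)] by blast
  obtain Q where Q: "semidecidable2 (\<lambda>n c. Q n (list_decode c))" "\<And>n. extension_closed (Q n)"
    "\<And>p n. \<psi> p n \<longleftrightarrow> (\<exists>m. Q n (initial p m))"
    using oracle_semidecidableE[OF assms(2)] by blast
  show ?thesis
  proof (rule oracle_semidecidableI)
    show "semidecidable2 (\<lambda>n c. P n (list_decode c) \<and> Q n (list_decode c))"
      by (intro semidecidable_intros P(1) Q(1))
    have "extension_closed (\<lambda>s. P n s \<and> Q n s)" for n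
      using P(2) Q(2) unfolding extension_closed_def by blast
    note eventually_initial_iff[OF this, symmetric]
    also have "(\<forall>\<^sub>F m in sequentially. P n (initial p m) \<and> Q n (initial p m)) \<longleftrightarrow>
        \<phi> p n \<and> \<psi> p n" for p n
      by (simp add: P(3) Q(3) eventually_conj_iff eventually_initial_iff P(2) Q(2))
    finally show "\<phi> p n \<and> \<psi> p n \<longleftrightarrow> (\<exists>m. P n (initial p m) \<and> Q n (initial p m))" for p n
      by (rule sym)
  qed
qed

lemma oracle_semidecidable_disj [oracle_semidecidable_intros]:
  assumes "oracle_semidecidable \<phi>" "oracle_semidecidable \<psi>"
  shows "oracle_semidecidable (\<lambda>p n. \<phi> p n \<or> \<psi> p n)"
proof -
  obtain P where P: "semidecidable2 (\<lambda>n c. P n (list_decode c))"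
    "\<And>p n. \<phi> p n \<longleftrightarrow> (\<exists>m. P n (initial p m))"
    using oracle_semidecidableE[OF assms(1)] by metis
  obtain Q where Q: "semidecidable2 (\<lambda>n c. Q n (list_decode c))"
    "\<And>p n. \<psi> p n \<longleftrightarrow> (\<exists>m. Q n (initial p m))"
    using oracle_semidecidableE[OF assms(2)] by metis
  have "semidecidable2 (\<lambda>n c. P n (list_decode c) \<or> Q n (list_decode c))"
    by (intro semidecidable_intros P(1) Q(1))
  then show ?thesis by (rule oracle_semidecidableI) (auto simp: P(2) Q(2))
qed

lemma oracle_semidecidable_ex [oracle_semidecidable_intros]:
  assumes "oracle_semidecidable (\<lambda>p z. \<phi> p (pfst z) (psnd z))"
  shows "oracle_semidecidable (\<lambda>p n. \<exists>k. \<phi> p n k)"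
proof -
  obtain P where P: "semidecidable2 (\<lambda>z c. P z (list_decode c))"
    "\<And>p z. \<phi> p (pfst z) (psnd z) \<longleftrightarrow> (\<exists>m. P z (initial p m))"
    using oracle_semidecidableE[OF assms] by metis
  have \<phi>_iff: "\<phi> p n k \<longleftrightarrow> (\<exists>m. P (prod_encode (n, k)) (initial p m))" for p n k
    using P(2)[of p "prod_encode (n, k)"] by simp
  have "semidecidable2 (\<lambda>n c. \<exists>k. P (prod_encode (n, k)) (list_decode c))"
    by (intro semidecidable_intros semidecidable_compose2[OF P(1)] computable_intros)
  then show ?thesis by (rule oracle_semidecidableI) (auto simp: \<phi>_iff)
qed

lemma oracle_semidecidable_ex_list [oracle_semidecidable_intros]:
  assumes "oracle_semidecidable (\<lambda>p z. \<phi> p (pfst z) (list_decode (psnd z)))"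
  shows "oracle_semidecidable (\<lambda>p n. \<exists>s. \<phi> p n s)"
  using oracle_semidecidable_ex[of "\<lambda>p n c. \<phi> p n (list_decode c)", OF assms]
  by (simp add: ex_list_decode)

lemma oracle_semidecidable_ball [oracle_semidecidable_intros]:
  assumes "computable f" "oracle_semidecidable (\<lambda>p z. \<phi> p (pfst z) (psnd z))"
  shows "oracle_semidecidable (\<lambda>p n. \<forall>k<f n. \<phi> p n k)"
proof -
  obtain P where P: "semidecidable2 (\<lambda>z c. P z (list_decode c))" "\<And>z. extension_closed (P z)"
    "\<And>p z. \<phi> p (pfst z) (psnd z) \<longleftrightarrow> (\<exists>m. P z (initial p m))"
    using oracle_semidecidableE[OF assms(2)] by blast
  have \<phi>_iff: "\<phi> p n k \<longleftrightarrow> (\<exists>m. P (prod_encode (n, k)) (initial p m))" for p n k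
    using P(3)[of p "prod_encode (n, k)"] by simp
  show ?thesis
  proof (rule oracle_semidecidableI)
    show "semidecidable2 (\<lambda>n c. \<forall>k<f n. P (prod_encode (n, k)) (list_decode c))"
      by (intro semidecidable_intros semidecidable_compose2[OF P(1)] computable_intros
          computable_compose[OF assms(1)])
    have "extension_closed (\<lambda>s. \<forall>k\<in>{..<f n}. P (prod_encode (n, k)) s)" for n
      using P(2) unfolding extension_closed_def by blast
    note eventually_initial_iff[OF this, symmetric]
    also have "(\<forall>\<^sub>F m in sequentially. \<forall>k\<in>{..<f n}. P (prod_encode (n, k)) (initial p m)) \<longleftrightarrow>
        (\<forall>k\<in>{..<f n}. \<phi> p n k)" for p n
      by (simp add: \<phi>_iff eventually_ball_finite_distrib eventually_initial_iff P(2))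
    finally show "(\<forall>k<f n. \<phi> p n k) \<longleftrightarrow> (\<exists>m. \<forall>k<f n. P (prod_encode (n, k)) (initial p m))" for p n
      unfolding Ball_def lessThan_iff by (rule sym)
  qed
qed

definition list_graph :: "nat list \<Rightarrow> nat \<Rightarrow> nat \<Rightarrow> bool" where
  "list_graph s u v \<longleftrightarrow> u < length s \<and> v = nth_default 0 s u"

lemma list_graph_initial: "list_graph (initial p m) = (\<lambda>u v. u < m \<and> v = p u)"
  by (auto simp: list_graph_def nth_default_def fun_eq_iff)

lemma semidecidable_list_graph:
  assumes "computable s" "computable f" "computable g"
  shows "semidecidable (\<lambda>x. list_graph (list_decode (s x)) (f x) (g x))"
  unfolding list_graph_def by (intro semidecidable_if_decidable computable_intros assms)

lemma oracle_semidecidable_query [oracle_semidecidable_intros]: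
  assumes "computable f" "computable g"
  shows "oracle_semidecidable (\<lambda>p n. p (f n) = g n)"
proof (rule oracle_semidecidableI)
  show "semidecidable2 (\<lambda>n c. list_graph (list_decode c) (f n) (g n))"
    by (intro semidecidable_list_graph computable_intros assms[THEN computable_compose])
qed (auto simp: list_graph_initial)

lemma eventually_derivable_initial:
  assumes "derivable (eval_rule (\<lambda>u v. v = p u)) t"
  shows "\<forall>\<^sub>F m in sequentially. derivable (eval_rule (\<lambda>u v. u < m \<and> v = p u)) t"
  using assms
proof induction
  case (derivable D t)
  have "\<forall>\<^sub>F m in sequentially. \<forall>u\<in>set D. derivable (eval_rule (\<lambda>u v. u < m \<and> v = p u)) u"
    using derivable.IH by (intro eventually_ball_finite) auto
  moreover have "\<forall>\<^sub>F m in sequentially. pfst (psnd t) < m"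
    by (rule eventually_gt_at_top)
  ultimately show ?case
  proof eventually_elim
    case (elim m)
    have "eval_rule (\<lambda>u v. u < m \<and> v = p u) D t"
      using derivable.hyps(2) unfolding eval_rule_def Let_def by (simp only: elim(2) simp_thms)
    then show ?case using elim(1) by (blast intro: derivable.derivable)
  qed
qed

lemma evals_iff_derivable_initial:
  "evals p c x y \<longleftrightarrow> (\<exists>m. derivable (eval_rule (list_graph (initial p m))) (triple (goedel c) x y))"
  unfolding evals_iff_derivable list_graph_initial
proof
  assume "derivable (eval_rule (\<lambda>u v. v = p u)) (triple (goedel c) x y)"
  then show "\<exists>m. derivable (eval_rule (\<lambda>u v. u < m \<and> v = p u)) (triple (goedel c) x y)"
    by (intro eventually_happens'[OF sequentially_bot] eventually_derivable_initial)
next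
  have "derivable (eval_rule (\<lambda>u v. v = p u)) t"
    if "derivable (eval_rule (\<lambda>u v. u < m \<and> v = p u)) t" for m t
    using that by induction (auto intro: derivable.derivable eval_rule_mono)
  then show "derivable (eval_rule (\<lambda>u v. v = p u)) (triple (goedel c) x y)"
    if "\<exists>m. derivable (eval_rule (\<lambda>u v. u < m \<and> v = p u)) (triple (goedel c) x y)"
    using that by blast
qed

lemma oracle_semidecidable_evals [oracle_semidecidable_intros]:
  assumes "computable f" "computable g"
  shows "oracle_semidecidable (\<lambda>p n. evals p c (f n) (g n))"
proof (rule oracle_semidecidableI)
  let ?J = "\<lambda>z. eval_rule (list_graph (list_decode (psnd z)))"
  have "semidecidable3 (\<lambda>z. list_graph (list_decode (psnd z)))"
    by (intro semidecidable_list_graph computable_intros)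
  from semidecidable_eval_rule[OF this]
  show "semidecidable2 (\<lambda>n s. derivable (eval_rule (list_graph (list_decode s)))
      (triple (goedel c) (f n) (g n)))"
    by (rule semidecidable_derivable[where J = ?J])
      (intro monotone_rule_eval_rule computable_intros assms[THEN computable_compose])+
qed (rule evals_iff_derivable_initial)

section \<open>Computably overt sets and \<open>\<Pi>\<^sup>0\<^sub>2\<close> sets\<close>

lemma computably_overt_iff:
  "computably_overt A \<longleftrightarrow> semidecidable (\<lambda>c. cylinder (list_decode c) \<inter> A \<noteq> {})"
proof -
  have "c \<in> list_encode ` {s. cylinder s \<inter> A \<noteq> {}} \<longleftrightarrow> cylinder (list_decode c) \<inter> A \<noteq> {}" for c
    by (metis (mono_tags, lifting) image_iff list_decode_inverse list_encode_inverse mem_Collect_eq)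
  then show ?thesis unfolding computably_overt_def ce_iff_semidecidable by simp
qed

lemma semidecidable_bex_overt:
  assumes "computably_overt A" "oracle_semidecidable \<phi>"
  shows "semidecidable (\<lambda>n. \<exists>p\<in>A. \<phi> p n)"
proof -
  obtain P where P: "semidecidable2 (\<lambda>n c. P n (list_decode c))"
    "\<And>p n. \<phi> p n \<longleftrightarrow> (\<exists>m. P n (initial p m))"
    using oracle_semidecidableE[OF assms(2)] by metis
  have "(\<exists>p\<in>A. \<phi> p n) \<longleftrightarrow> (\<exists>s. cylinder s \<inter> A \<noteq> {} \<and> P n s)" for n
    unfolding P(2) ex_mem_cylinder_iff[symmetric] by blast
  moreover have "semidecidable (\<lambda>n. \<exists>s. cylinder s \<inter> A \<noteq> {} \<and> P n s)"
    by (intro semidecidable_intros semidecidable_compose2[OF P(1)] computable_intros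
        semidecidable_compose[OF assms(1)[unfolded computably_overt_iff]])
  ultimately show ?thesis by simp
qed

lemma Pi02_Collect_all:
  assumes "oracle_semidecidable \<phi>" shows "Pi02 {p. \<forall>n. \<phi> p n}"
proof -
  have "oracle_semidecidable (\<lambda>_ _. True)"
    by (intro oracle_semidecidable_if_semidecidable semidecidable_if_decidable computable_intros)
  moreover have "- {p. \<forall>n. \<phi> p n} = (\<Union>n. {p. True} - {p. \<phi> p n})" by auto
  ultimately show ?thesis
    using assms unfolding Pi02_def Sigma02_def oracle_semidecidable_def by blast
qed

text \<open>
  An inclusion \<open>U \<subseteq> V\<close> between open sets is not an open requirement, but splits into open ones,
  indexed by the stages \<open>(i, w)\<close> at which the enumeration of \<open>U\<close> produces a cylinder: leaving
  that cylinder is witnessed by finitely many values.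
\<close>

lemma Pi02E:
  assumes "Pi02 A"
  obtains \<phi> where "oracle_semidecidable \<phi>" "A = {p. \<forall>n. \<phi> p n}"
proof -
  obtain U V where U: "uniformly_eff_open baire_basis U" and V: "uniformly_eff_open baire_basis V"
    and A: "- A = (\<Union>n. U n - V n)"
    using assms unfolding Pi02_def Sigma02_def by blast
  obtain P where P: "semidecidable2 P" "\<And>n. U n = (\<Union>i\<in>{i. P n i}. baire_basis i)"
    using uniformly_eff_openE[OF U] by metis
  obtain R where R: "decidable3 R" "\<And>n i. P n i \<longleftrightarrow> (\<exists>w. R n i w)"
    using semidecidable2E[OF P(1)] by blast
  define leaves where "leaves p i \<longleftrightarrow> (\<exists>j v. p j = v \<and> j < length (list_decode i) \<and>
    v \<noteq> nth_default 0 (list_decode i) j)" for p :: "nat \<Rightarrow> nat" and i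
  have leaves_iff: "leaves p i \<longleftrightarrow> p \<notin> baire_basis i" for p i
    by (auto simp: leaves_def baire_basis_def cylinder_def nth_default_def)
  define \<phi> where "\<phi> p n i w \<longleftrightarrow> \<not> R n i w \<or> leaves p i \<or> p \<in> V n" for p n i w
  show ?thesis
  proof (rule that)
    have mem_V: "oracle_semidecidable (\<lambda>p n. p \<in> V n)"
      using V by (simp add: oracle_semidecidable_def)
    show "oracle_semidecidable (\<lambda>p z. \<phi> p (pfst z) (pfst (psnd z)) (psnd (psnd z)))"
      unfolding \<phi>_def leaves_def
      by (intro oracle_semidecidable_intros oracle_semidecidable_if_semidecidable
          semidecidable_if_decidable oracle_semidecidable_compose[OF mem_V]
          decidable_compose3[OF R(1)] computable_intros)
    have "A = {p. \<forall>n. p \<in> U n \<longrightarrow> p \<in> V n}" using A by auto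
    then have "A = {p. \<forall>n i w. \<phi> p n i w}" by (auto simp: P(2) R(2) \<phi>_def leaves_iff)
    moreover have "(\<forall>n i w. Q n i w) \<longleftrightarrow> (\<forall>z. Q (pfst z) (pfst (psnd z)) (psnd (psnd z)))"
      for Q :: "nat \<Rightarrow> nat \<Rightarrow> nat \<Rightarrow> bool"
      by (metis prod_encode_inverse fst_conv snd_conv)
    ultimately show "A = {p. \<forall>z. \<phi> p (pfst z) (pfst (psnd z)) (psnd (psnd z))}" by auto
  qed
qed

lemma Pi02_Int:
  assumes "Pi02 A" "Pi02 C" shows "Pi02 (A \<inter> C)"
proof -
  obtain \<phi> where \<phi>: "oracle_semidecidable \<phi>" "A = {p. \<forall>n. \<phi> p n}"
    using Pi02E[OF assms(1)] .
  obtain \<psi> where \<psi>: "oracle_semidecidable \<psi>" "C = {p. \<forall>n. \<psi> p n}"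
    using Pi02E[OF assms(2)] .
  have "Pi02 {p. \<forall>n. \<phi> p n \<and> \<psi> p n}"
    by (intro Pi02_Collect_all oracle_semidecidable_intros \<phi>(1) \<psi>(1))
  moreover have "A \<inter> C = {p. \<forall>n. \<phi> p n \<and> \<psi> p n}" using \<phi>(2) \<psi>(2) by auto
  ultimately show ?thesis by simp
qed

section \<open>Computably overt \<open>\<Pi>\<^sup>0\<^sub>2\<close> sets are effective quasi-Polish\<close>

locale refinement =
  fixes A :: "(nat \<Rightarrow> nat) set" and U :: "nat \<Rightarrow> (nat \<Rightarrow> nat) set"
    and refine :: "nat list \<Rightarrow> nat \<Rightarrow> nat list"
  assumes nonempty: "A \<noteq> {}" and A_eq: "A = (\<Inter>n. U n)"
    and prefix_refine: "cylinder s \<inter> A \<noteq> {} \<Longrightarrow> prefix s (refine s k)"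
    and length_refine: "cylinder s \<inter> A \<noteq> {} \<Longrightarrow> length s < length (refine s k)"
    and refine_meets: "cylinder s \<inter> A \<noteq> {} \<Longrightarrow> cylinder (refine s k) \<inter> A \<noteq> {}"
    and refine_subset: "cylinder s \<inter> A \<noteq> {} \<Longrightarrow> n \<le> length s \<Longrightarrow> cylinder (refine s k) \<subseteq> U n"
    and refine_cover: "p \<in> A \<Longrightarrow> p \<in> cylinder s \<Longrightarrow> \<exists>k. p \<in> cylinder (refine s k)"
begin

definition node :: "nat list \<Rightarrow> nat list" where
  "node \<sigma> = fold (\<lambda>k s. refine s k) \<sigma> []"

lemma node_Nil [simp]: "node [] = []"
  by (simp add: node_def)

lemma node_snoc [simp]: "node (\<sigma> @ [k]) = refine (node \<sigma>) k"
  by (simp add: node_def)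

lemma node_meets: "cylinder (node \<sigma>) \<inter> A \<noteq> {}"
  by (induction \<sigma> rule: rev_induct) (simp_all add: nonempty refine_meets)

lemma length_node: "length \<sigma> \<le> length (node \<sigma>)"
proof (induction \<sigma> rule: rev_induct)
  case (snoc k \<sigma>)
  then show ?case using length_refine[OF node_meets[of \<sigma>], of k] by simp
qed simp

lemma node_prefix_mono: "prefix \<sigma> \<tau> \<Longrightarrow> prefix (node \<sigma>) (node \<tau>)"
proof (induction \<tau> rule: rev_induct)
  case (snoc k \<tau>)
  have "prefix (node \<tau>) (node (\<tau> @ [k]))"
    by (simp add: prefix_refine node_meets)
  with snoc show ?case by (auto simp: prefix_snoc intro: prefix_order.trans)
qed simp

definition limit :: "(nat \<Rightarrow> nat) \<Rightarrow> nat \<Rightarrow> nat" where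
  "limit q i = node (initial q (Suc i)) ! i"

lemma limit_mem_cylinder_node: "limit q \<in> cylinder (node (initial q m))"
  unfolding cylinder_def
proof (intro CollectI allI impI)
  fix i assume i: "i < length (node (initial q m))"
  have i': "i < length (node (initial q (Suc i)))"
    using length_node[of "initial q (Suc i)"] by simp
  consider "prefix (initial q (Suc i)) (initial q m)" | "prefix (initial q m) (initial q (Suc i))"
    by (metis nat_le_linear prefix_initial)
  then show "limit q i = node (initial q m) ! i"
    unfolding limit_def
  proof cases
    case 1
    show "node (initial q (Suc i)) ! i = node (initial q m) ! i"
      using node_prefix_mono[OF 1] i' by (auto simp: prefix_def nth_append)
  next
    case 2
    show "node (initial q (Suc i)) ! i = node (initial q m) ! i"
      using node_prefix_mono[OF 2] i by (auto simp: prefix_def nth_append)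
  qed
qed

lemma limit_eqI:
  assumes "\<And>m. m \<ge> N \<Longrightarrow> p \<in> cylinder (node (initial q m))" shows "limit q = p"
proof
  fix i
  let ?s = "node (initial q (max N (Suc i)))"
  have "i < length ?s" using length_node[of "initial q (max N (Suc i))"] by simp
  moreover have "p \<in> cylinder ?s" "limit q \<in> cylinder ?s"
    using assms limit_mem_cylinder_node by auto
  ultimately show "limit q i = p i" by (simp add: cylinder_def)
qed

lemma limit_mem: "limit q \<in> A"
proof -
  have "limit q \<in> U n" for n
  proof -
    have "n \<le> length (node (initial q n))" using length_node[of "initial q n"] by simp
    then have "cylinder (node (initial q (Suc n))) \<subseteq> U n"
      by (simp add: initial_Suc refine_subset node_meets)
    then show ?thesis using limit_mem_cylinder_node by blast
  qed
  then show ?thesis by (simp add: A_eq)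
qed

text \<open>
  The preimage of \<open>p\<close> under \<^const>\<open>limit\<close> is found by recursion on the position in the tree: past
  \<open>\<sigma>\<close>, each value selects a refinement of the current node that still contains \<open>p\<close>.
\<close>

lemma ex_limit_eq:
  assumes "p \<in> A" "p \<in> cylinder (node \<sigma>)"
  obtains q where "q \<in> cylinder \<sigma>" "limit q = p"
proof -
  define select where
    "select n s = (if n < length \<sigma> then \<sigma> ! n else SOME k. p \<in> cylinder (refine s k))" for n s
  define t where "t = rec_nat [] (\<lambda>n s. refine s (select n s))"
  define q where "q n = select n (t n)" for n
  have t_eq: "t n = node (initial q n)" for n
  proof (induction n)
    case 0
    show ?case by (simp add: t_def initial_def)
  next
    case (Suc n)
    have "t (Suc n) = refine (t n) (q n)" by (simp add: t_def q_def)
    then show ?case by (simp add: Suc initial_Suc)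
  qed
  have q_eq: "q n = select n (node (initial q n))" for n by (metis q_def t_eq)
  have q: "q \<in> cylinder \<sigma>" by (simp add: cylinder_def q_def select_def)
  have "p \<in> cylinder (node (initial q m))" if "m \<ge> length \<sigma>" for m
    using that
  proof (induction m rule: dec_induct)
    case base
    show ?case using assms(2) q by (simp add: mem_cylinder_iff_initial)
  next
    case (step m)
    have "p \<in> cylinder (refine (node (initial q m)) (q m))"
      using someI_ex[OF refine_cover[OF assms(1) step.IH]] step.hyps
      by (subst q_eq) (simp add: select_def)
    then show ?case by (simp add: initial_Suc)
  qed
  then have "limit q = p" by (rule limit_eqI)
  with q show ?thesis by (rule that)
qed

lemma image_limit_cylinder: "limit ` cylinder \<sigma> = cylinder (node \<sigma>) \<inter> A"
proof (intro equalityI subsetI)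
  fix p assume "p \<in> limit ` cylinder \<sigma>"
  then obtain q where "q \<in> cylinder \<sigma>" "p = limit q" by blast
  then show "p \<in> cylinder (node \<sigma>) \<inter> A"
    using limit_mem_cylinder_node[of q "length \<sigma>"] limit_mem by (simp add: mem_cylinder_iff_initial)
next
  fix p assume "p \<in> cylinder (node \<sigma>) \<inter> A"
  then show "p \<in> limit ` cylinder \<sigma>" using ex_limit_eq[of p \<sigma>] by blast
qed

lemma range_limit: "range limit = A"
  using image_limit_cylinder[of "[]"] by simp

lemma limit_mem_cylinder_iff:
  "limit q \<in> cylinder s \<longleftrightarrow> (\<exists>\<sigma>. q \<in> cylinder \<sigma> \<and> prefix s (node \<sigma>))"
proof
  assume *: "limit q \<in> cylinder s"
  let ?\<sigma> = "initial q (length s)"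
  have "initial (limit q) (length (node ?\<sigma>)) = node ?\<sigma>"
    using limit_mem_cylinder_node by (simp add: mem_cylinder_iff_initial)
  moreover have "prefix s (initial (limit q) (length (node ?\<sigma>)))"
    using * length_node[of ?\<sigma>] by (simp add: prefix_initial_iff)
  ultimately show "\<exists>\<sigma>. q \<in> cylinder \<sigma> \<and> prefix s (node \<sigma>)"
    by (intro exI[of _ ?\<sigma>]) simp
next
  assume "\<exists>\<sigma>. q \<in> cylinder \<sigma> \<and> prefix s (node \<sigma>)"
  then obtain \<sigma> where "q \<in> cylinder \<sigma>" "prefix s (node \<sigma>)" by blast
  moreover from this have "limit q \<in> cylinder (node \<sigma>)" using image_limit_cylinder by blast
  ultimately show "limit q \<in> cylinder s" using cylinder_antimono by blast
qed

lemma effective_quasi_Polish_if_computable_node: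
  assumes "computable (\<lambda>c. list_encode (node (list_decode c)))"
  shows "effective_quasi_Polish (top_of_set A) (\<lambda>i. baire_basis i \<inter> A)"
proof -
  let ?C = "\<lambda>i. baire_basis i \<inter> A"
  have "uniformly_eff_open baire_basis (\<lambda>i. limit -` ?C i)"
  proof (rule uniformly_eff_openI)
    have "decidable2
        (\<lambda>i c. prefix (list_decode i) (list_decode (list_encode (node (list_decode c)))))"
      by (intro computable_intros computable_compose[OF assms])
    then show "semidecidable2 (\<lambda>i c. prefix (list_decode i) (node (list_decode c)))"
      by (simp add: semidecidable_if_decidable)
    have "limit q \<in> cylinder s \<longleftrightarrow>
        (\<exists>c. q \<in> cylinder (list_decode c) \<and> prefix s (node (list_decode c)))" for q s
      using ex_list_decode[of "\<lambda>\<sigma>. q \<in> cylinder \<sigma> \<and> prefix s (node \<sigma>)"]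
      by (simp add: limit_mem_cylinder_iff)
    then show "limit -` ?C i =
        (\<Union>c\<in>{c. prefix (list_decode i) (node (list_decode c))}. baire_basis c)" for i
      by (auto simp: baire_basis_def limit_mem)
  qed
  moreover have "uniformly_eff_open ?C (\<lambda>n. limit ` cylinder (list_decode n))"
  proof (rule uniformly_eff_openI)
    show "semidecidable2 (\<lambda>n i. i = list_encode (node (list_decode n)))"
      by (intro semidecidable_if_decidable computable_intros computable_compose[OF assms])
    show "limit ` cylinder (list_decode n) =
        (\<Union>i\<in>{i. i = list_encode (node (list_decode n))}. ?C i)" for n
      by (simp add: image_limit_cylinder baire_basis_def)
  qed
  ultimately show ?thesis
    unfolding effective_quasi_Polish_def topspace_euclidean_subtopology using range_limit by blast
qed

end

lemma semidecidable_enumeration_list: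
  assumes "semidecidable2 (\<lambda>c d. P (list_decode c) (list_decode d))"
  obtains h where
    "computable_on {z. \<exists>t. P (list_decode (pfst z)) t}
      (\<lambda>z. list_encode (h (list_decode (pfst z)) (psnd z)))"
    "\<And>s. \<exists>t. P s t \<Longrightarrow> range (h s) = {t. P s t}"
proof -
  obtain e where e: "computable_on {z. \<exists>d. P (list_decode (pfst z)) (list_decode d)} e"
    "\<And>c. \<exists>d. P (list_decode c) (list_decode d) \<Longrightarrow>
      range (\<lambda>k. e (prod_encode (c, k))) = {d. P (list_decode c) (list_decode d)}"
    using semidecidable_enumeration[OF assms] by blast
  define h where "h s k = list_decode (e (prod_encode (list_encode s, k)))" for s k
  have ex_P: "(\<exists>d. P s (list_decode d)) \<longleftrightarrow> (\<exists>t. P s t)" for s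
    by (rule ex_list_decode)
  show ?thesis
  proof (rule that[of h])
    have "list_encode (h (list_decode (pfst z)) (psnd z)) = e z" for z
      by (simp add: h_def)
    then show "computable_on {z. \<exists>t. P (list_decode (pfst z)) t}
        (\<lambda>z. list_encode (h (list_decode (pfst z)) (psnd z)))"
      using e(1) by (simp add: ex_P)
    fix s assume "\<exists>t. P s t"
    then have "range (\<lambda>k. e (prod_encode (list_encode s, k))) = {d. P s (list_decode d)}"
      using e(2)[of "list_encode s"] by (simp add: ex_P)
    moreover have "range (h s) = list_decode ` range (\<lambda>k. e (prod_encode (list_encode s, k)))"
      by (auto simp: h_def)
    ultimately show "range (h s) = {t. P s t}"
      by (auto intro: image_eqI[of _ _ "list_encode _"])
  qed
qed

lemma computable_fold_list:
  assumes h: "computable_on {z. I (list_decode (pfst z))}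
      (\<lambda>z. list_encode (h (list_decode (pfst z)) (psnd z)))"
    and "I []" "\<And>s k. I s \<Longrightarrow> I (h s k)"
  shows "computable (\<lambda>c. list_encode (fold (\<lambda>k s. h s k) (list_decode c) []))"
proof -
  let ?step = "\<lambda>k a. list_encode (h (list_decode a) k)"
  have "computable (\<lambda>z. prod_encode (psnd z, pfst z))" by (intro computable_intros)
  from computable_on_compose[OF h this, of "{z. I (list_decode (psnd z))}"]
  have "computable_on {z. I (list_decode (psnd z))} (\<lambda>z. ?step (pfst z) (psnd z))" by simp
  then have "computable (\<lambda>c. fold ?step (list_decode c) 0)"
    by (rule computable_fold_on[rotated 2, where I = "\<lambda>a. I (list_decode a)"])
      (use assms(2,3) in \<open>auto intro: computable_intros\<close>)
  moreover have "fold ?step \<sigma> (list_encode s) = list_encode (fold (\<lambda>k s. h s k) \<sigma> s)" for \<sigma> s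
    by (induction \<sigma> arbitrary: s) simp_all
  from this[of _ "[]"] have "fold ?step \<sigma> 0 = list_encode (fold (\<lambda>k s. h s k) \<sigma> [])" for \<sigma>
    by simp
  ultimately show ?thesis by simp
qed

definition strict_refinement ::
  "(nat \<Rightarrow> nat) set \<Rightarrow> (nat \<Rightarrow> nat list \<Rightarrow> bool) \<Rightarrow> nat list \<Rightarrow> nat list \<Rightarrow> bool" where
  "strict_refinement A P s t \<longleftrightarrow>
     prefix s t \<and> length s < length t \<and> cylinder t \<inter> A \<noteq> {} \<and> (\<forall>n<Suc (length s). P n t)"

lemma ex_strict_refinement:
  assumes "\<And>n. extension_closed (P n)" "A = {p. \<forall>n. \<exists>m. P n (initial p m)}"
    and "p \<in> A" "p \<in> cylinder s"
  shows "\<exists>t. strict_refinement A P s t \<and> p \<in> cylinder t"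
proof -
  have "\<forall>\<^sub>F m in sequentially. P n (initial p m)" for n
    using \<open>p \<in> A\<close> by (simp add: eventually_initial_iff assms(1,2))
  then have "\<forall>\<^sub>F m in sequentially. length s < m \<and> (\<forall>n\<in>{..<Suc (length s)}. P n (initial p m))"
    by (intro eventually_conj eventually_gt_at_top eventually_ball_finite) auto
  then obtain m where "length s < m" "\<forall>n\<in>{..<Suc (length s)}. P n (initial p m)"
    using eventually_happens'[OF sequentially_bot] by blast
  moreover have "cylinder (initial p m) \<inter> A \<noteq> {}" using \<open>p \<in> A\<close> mem_cylinder_initial by blast
  ultimately have "strict_refinement A P s (initial p m)"
    using \<open>p \<in> cylinder s\<close> by (simp add: strict_refinement_def prefix_initial_iff)
  then show ?thesis using mem_cylinder_initial by blast
qed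

lemma refinement_if_range:
  assumes P: "\<And>n. extension_closed (P n)" "A = {p. \<forall>n. \<exists>m. P n (initial p m)}" and "A \<noteq> {}"
    and range: "\<And>s. cylinder s \<inter> A \<noteq> {} \<Longrightarrow> range (h s) = {t. strict_refinement A P s t}"
  shows "refinement A (\<lambda>n. {p. \<exists>m. P n (initial p m)}) h"
proof
  fix s k n assume "cylinder s \<inter> A \<noteq> {}"
  then have h: "strict_refinement A P s (h s k)" using range by blast
  then show "prefix s (h s k)" "length s < length (h s k)" "cylinder (h s k) \<inter> A \<noteq> {}"
    by (simp_all add: strict_refinement_def)
  assume "n \<le> length s"
  then have "P n (h s k)" using h by (simp add: strict_refinement_def)
  then show "cylinder (h s k) \<subseteq> {p. \<exists>m. P n (initial p m)}"
    by (auto simp: ex_mem_cylinder_iff[symmetric])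
next
  fix p s assume p: "p \<in> A" "p \<in> cylinder s"
  then obtain t where t: "strict_refinement A P s t" "p \<in> cylinder t"
    using ex_strict_refinement[OF P] by blast
  have "range (h s) = {t. strict_refinement A P s t}" using p by (intro range) blast
  then have "t \<in> range (h s)" using t(1) by blast
  then show "\<exists>k. p \<in> cylinder (h s k)" using t(2) by blast
qed (use assms in auto)

theorem effective_quasi_Polish_if_overt_Pi02:
  assumes "computably_overt A" "Pi02 A"
  shows "effective_quasi_Polish (top_of_set A) (\<lambda>i. baire_basis i \<inter> A)"
proof (cases "A = {}")
  case True
  then show ?thesis by (simp add: effective_quasi_Polish_def)
next
  case False
  obtain \<phi> where \<phi>: "oracle_semidecidable \<phi>" "A = {p. \<forall>n. \<phi> p n}"
    using Pi02E[OF assms(2)] .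
  obtain P where P_sd: "semidecidable2 (\<lambda>n c. P n (list_decode c))"
    and P_ext: "\<And>n. extension_closed (P n)"
    and P_iff: "\<And>p n. \<phi> p n \<longleftrightarrow> (\<exists>m. P n (initial p m))"
    using oracle_semidecidableE[OF \<phi>(1)] by blast
  have A_eq: "A = {p. \<forall>n. \<exists>m. P n (initial p m)}" using \<phi>(2) P_iff by simp
  have "semidecidable2 (\<lambda>c d. strict_refinement A P (list_decode c) (list_decode d))"
    unfolding strict_refinement_def
    by (intro semidecidable_intros semidecidable_compose2[OF P_sd]
        semidecidable_compose[OF assms(1)[unfolded computably_overt_iff]]
        semidecidable_if_decidable computable_intros)
  then obtain h where h: "computable_on {z. \<exists>t. strict_refinement A P (list_decode (pfst z)) t}
      (\<lambda>z. list_encode (h (list_decode (pfst z)) (psnd z)))"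
    "\<And>s. \<exists>t. strict_refinement A P s t \<Longrightarrow> range (h s) = {t. strict_refinement A P s t}"
    using semidecidable_enumeration_list[of "strict_refinement A P"] by blast
  have meets_iff: "(\<exists>t. strict_refinement A P s t) \<longleftrightarrow> cylinder s \<inter> A \<noteq> {}" for s
    using ex_strict_refinement[OF P_ext A_eq] cylinder_antimono
    unfolding strict_refinement_def by blast
  interpret refinement A "\<lambda>n. {p. \<exists>m. P n (initial p m)}" h
    using P_ext A_eq False h(2) unfolding meets_iff by (rule refinement_if_range)
  have "computable (\<lambda>c. list_encode (node (list_decode c)))"
    unfolding node_def using h(1)
    by (rule computable_fold_list) (use nonempty refine_meets in \<open>simp_all add: meets_iff\<close>)
  then show ?thesis by (rule effective_quasi_Polish_if_computable_node)
qed

section \<open>Operators on Baire space computed by programs\<close>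

definition computes :: "prog \<Rightarrow> (nat \<Rightarrow> nat) \<Rightarrow> (nat \<Rightarrow> nat) \<Rightarrow> bool" where
  "computes c p q \<longleftrightarrow> (\<forall>n. evals p c n (q n))"

lemma evals_iff_if_computes: "computes c p q \<Longrightarrow> evals p c n y \<longleftrightarrow> q n = y"
  unfolding computes_def using evals_functional by blast

lemma computes_functional: "computes c p q \<Longrightarrow> computes c p r \<Longrightarrow> q = r"
  by (rule ext) (use evals_iff_if_computes computes_def in blast)

lemma ex_computes_iff: "(\<exists>q. computes c p q) \<longleftrightarrow> (\<forall>n. \<exists>y. evals p c n y)"
  unfolding computes_def by metis

primrec subst_query :: "prog \<Rightarrow> prog \<Rightarrow> prog" where
  "subst_query d PZero = PZero"
| "subst_query d PSucc = PSucc"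
| "subst_query d PFst = PFst"
| "subst_query d PSnd = PSnd"
| "subst_query d PQuery = d"
| "subst_query d (PPair c c') = PPair (subst_query d c) (subst_query d c')"
| "subst_query d (PComp c c') = PComp (subst_query d c) (subst_query d c')"
| "subst_query d (PRec c c') = PRec (subst_query d c) (subst_query d c')"
| "subst_query d (PMin c) = PMin (subst_query d c)"

lemma evals_subst_query:
  assumes "evals q c x y" "computes d p q" shows "evals p (subst_query d c) x y"
  using assms(1)
proof (induction rule: evals.induct)
  case (query x)
  then show ?case using assms(2) by (simp add: computes_def)
next
  case (min c x n)
  then show ?case by (auto intro!: evals.min)
qed (auto intro: evals.intros)

lemma computes_subst_query:
  "computes d p q \<Longrightarrow> computes c q r \<Longrightarrow> computes (subst_query d c) p r"
  using evals_subst_query unfolding computes_def by blast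

lemma mem_cylinder_iff_evals:
  assumes "computes c p q"
  shows "q \<in> cylinder s \<longleftrightarrow> (\<forall>j<length s. evals p c j (nth_default 0 s j))"
  by (auto simp: evals_iff_if_computes[OF assms] cylinder_def nth_default_def)

lemma Pi02_preimage:
  assumes "Pi02 A" shows "Pi02 {p. \<exists>q\<in>A. computes c p q}"
proof -
  obtain \<phi> where \<phi>: "oracle_semidecidable \<phi>" "A = {p. \<forall>n. \<phi> p n}"
    using Pi02E[OF assms] .
  obtain P where P: "semidecidable2 (\<lambda>n c. P n (list_decode c))"
    "\<And>p n. \<phi> p n \<longleftrightarrow> (\<exists>m. P n (initial p m))"
    using oracle_semidecidableE[OF \<phi>(1)] by metis
  define \<psi> where "\<psi> p n \<longleftrightarrow> (\<exists>y. evals p c n y) \<and>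
    (\<exists>s. P n s \<and> (\<forall>j<length s. evals p c j (nth_default 0 s j)))" for p n
  have "oracle_semidecidable \<psi>"
    unfolding \<psi>_def
    by (intro oracle_semidecidable_intros oracle_semidecidable_if_semidecidable
        semidecidable_compose2[OF P(1)] computable_intros)
  then have "Pi02 {p. \<forall>n. \<psi> p n}" by (rule Pi02_Collect_all)
  moreover have "(\<exists>q\<in>A. computes c p q) \<longleftrightarrow> (\<forall>n. \<psi> p n)" for p
  proof (cases "\<exists>q. computes c p q")
    case True
    then obtain q where q: "computes c p q" by blast
    have "(\<exists>q\<in>A. computes c p q) \<longleftrightarrow> q \<in> A"
      using q computes_functional by blast
    also have "\<dots> \<longleftrightarrow> (\<forall>n. \<exists>s. q \<in> cylinder s \<and> P n s)"
      by (simp add: \<phi>(2) P(2) ex_mem_cylinder_iff)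
    also have "\<dots> \<longleftrightarrow> (\<forall>n. \<psi> p n)"
      using True[unfolded ex_computes_iff] mem_cylinder_iff_evals[OF q] unfolding \<psi>_def by blast
    finally show ?thesis .
  next
    case False
    then show ?thesis using ex_computes_iff[of c p] unfolding \<psi>_def by blast
  qed
  ultimately show ?thesis by simp
qed

lemma enumerated_set_subset_iff:
  "enumerated_set p \<subseteq> enumerated_set q \<longleftrightarrow> (\<forall>i. p i = 0 \<or> (\<exists>j. q j = p i))"
  unfolding enumerated_set_def by (auto simp: subset_iff) (metis not0_implies_Suc nat.distinct(1))+

lemma Pi02_enumerated_set_fixed:
  "Pi02 {p. \<exists>q. computes c p q \<and> enumerated_set q = enumerated_set p}"
proof -
  define \<psi> where "\<psi> p n \<longleftrightarrow> (\<exists>v. evals p c n v \<and> (v = 0 \<or> (\<exists>j. p j = v))) \<and>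
    (\<exists>v. p n = v \<and> (v = 0 \<or> (\<exists>j. evals p c j v)))" for p n
  have "oracle_semidecidable \<psi>"
    unfolding \<psi>_def
    by (intro oracle_semidecidable_intros oracle_semidecidable_if_semidecidable
        semidecidable_if_decidable computable_intros)
  then have "Pi02 {p. \<forall>n. \<psi> p n}" by (rule Pi02_Collect_all)
  moreover have "(\<exists>q. computes c p q \<and> enumerated_set q = enumerated_set p) \<longleftrightarrow> (\<forall>n. \<psi> p n)" for p
  proof (cases "\<exists>q. computes c p q")
    case True
    then obtain q where q: "computes c p q" by blast
    have "(\<exists>q. computes c p q \<and> enumerated_set q = enumerated_set p) \<longleftrightarrow>
        enumerated_set q \<subseteq> enumerated_set p \<and> enumerated_set p \<subseteq> enumerated_set q"
      using q computes_functional by blast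
    also have "\<dots> \<longleftrightarrow> (\<forall>n. \<psi> p n)"
      unfolding enumerated_set_subset_iff \<psi>_def evals_iff_if_computes[OF q] by metis
    finally show ?thesis .
  next
    case False
    then show ?thesis using ex_computes_iff[of c p] unfolding \<psi>_def by blast
  qed
  ultimately show ?thesis by simp
qed

section \<open>The standard representation\<close>

lemma inj_on_canonical_embedding:
  assumes "effective_topological_space X B"
  shows "inj_on (canonical_embedding B) (topspace X)"
proof (rule inj_onI)
  fix x y assume xy: "x \<in> topspace X" "y \<in> topspace X"
    "canonical_embedding B x = canonical_embedding B y"
  have B: "x \<in> B i \<longleftrightarrow> y \<in> B i" for i using xy(3) unfolding canonical_embedding_def by blast
  show "x = y"
  proof (rule ccontr)
    assume "x \<noteq> y"
    then obtain U where "openin X U" "x \<notin> U \<longleftrightarrow> y \<in> U"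
      using assms xy unfolding effective_topological_space_def t0_space_def by blast
    then show False using assms B unfolding effective_topological_space_def by blast
  qed
qed

lemma standard_representation_eq_Some_iff:
  assumes "effective_topological_space X B"
  shows "standard_representation X B p = Some x \<longleftrightarrow>
    x \<in> topspace X \<and> enumerated_set p = canonical_embedding B x"
  using the_inv_into_f_f[OF inj_on_canonical_embedding[OF assms]]
  by (auto simp: standard_representation_def)

definition listed_set :: "nat list \<Rightarrow> nat set" where
  "listed_set s = {n. Suc n \<in> set s}"

lemma mem_enumerated_set_iff: "n \<in> enumerated_set p \<longleftrightarrow> (\<exists>s. p \<in> cylinder s \<and> n \<in> listed_set s)"
proof -
  have "Suc n \<in> set (initial p m) \<longleftrightarrow> (\<exists>i<m. p i = Suc n)" for m
    by (auto simp: in_set_conv_nth)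
  then show ?thesis
    unfolding ex_mem_cylinder_iff listed_set_def enumerated_set_def by auto
qed

lemma listed_set_subset_enumerated_set_iff:
  "listed_set s \<subseteq> enumerated_set p \<longleftrightarrow>
    (\<forall>i<length s. nth_default 0 s i = 0 \<or> (\<exists>j. p j = nth_default 0 s i))"
proof -
  have "(\<forall>i<length s. nth_default 0 s i = 0 \<or> (\<exists>j. p j = nth_default 0 s i)) \<longleftrightarrow>
      (\<forall>v\<in>set s. v = 0 \<or> (\<exists>j. p j = v))"
    by (simp add: all_set_conv_all_nth nth_default_def)
  also have "\<dots> \<longleftrightarrow> listed_set s \<subseteq> enumerated_set p"
    unfolding listed_set_def enumerated_set_def by (auto simp: subset_iff) (metis not0_implies_Suc)
  finally show ?thesis by simp
qed

lemma ex_cylinder_enumerated_set_eq_iff: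
  "(\<exists>p\<in>cylinder s. enumerated_set p = M) \<longleftrightarrow> listed_set s \<subseteq> M"
proof
  assume "\<exists>p\<in>cylinder s. enumerated_set p = M"
  then show "listed_set s \<subseteq> M" using mem_enumerated_set_iff by blast
next
  assume M: "listed_set s \<subseteq> M"
  define p where "p i = (if i < length s then s ! i
    else if i - length s \<in> M then Suc (i - length s) else 0)" for i
  have "enumerated_set p = M"
  proof (intro equalityI subsetI)
    fix n assume "n \<in> enumerated_set p"
    then obtain i where i: "p i = Suc n" by (auto simp: enumerated_set_def)
    show "n \<in> M"
    proof (cases "i < length s")
      case True
      then have "Suc n \<in> set s" using i by (metis nth_mem p_def)
      then show ?thesis using M by (auto simp: listed_set_def)
    next
      case False
      then show ?thesis using i by (auto simp: p_def split: if_splits)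
    qed
  next
    fix n assume "n \<in> M"
    then have "p (length s + n) = n + 1" by (simp add: p_def)
    then show "n \<in> enumerated_set p" unfolding enumerated_set_def by blast
  qed
  moreover have "p \<in> cylinder s" by (simp add: cylinder_def p_def)
  ultimately show "\<exists>p\<in>cylinder s. enumerated_set p = M" by blast
qed

lemma ex_cylinder_standard_representation_iff:
  assumes "effective_topological_space X B"
  shows "(\<exists>p\<in>cylinder s. standard_representation X B p = Some x) \<longleftrightarrow>
    x \<in> topspace X \<and> listed_set s \<subseteq> canonical_embedding B x"
  unfolding standard_representation_eq_Some_iff[OF assms]
    ex_cylinder_enumerated_set_eq_iff[symmetric]
  by blast

lemma topspace_eq_UN_basis:
  assumes "effective_topological_space X B" shows "topspace X = (\<Union>i. B i)"
proof -
  have "B i \<subseteq> topspace X" for i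
    using assms unfolding effective_topological_space_def by (simp add: openin_subset)
  moreover have "\<exists>i. x \<in> B i" if "x \<in> topspace X" for x
    using assms that openin_topspace[of X] unfolding effective_topological_space_def by blast
  ultimately show ?thesis by blast
qed

lemma computable_intersection_index:
  assumes "effective_topological_space X B"
  obtains h where "computable h"
    "\<And>i e. eff_open_set B (h (prod_encode (i, e))) = B i \<inter> eff_open_set B e"
proof -
  obtain f where f: "computable2 f" "\<And>i j. B i \<inter> B j = (\<Union>k\<in>W (f i j). B k)"
    using assms unfolding effective_topological_space_def eff_open_set_def by blast
  have "semidecidable2 (\<lambda>z k. \<exists>j. j \<in> W (psnd z) \<and> k \<in> W (f (pfst z) j))"
    by (intro semidecidable_intros semidecidable_mem_W computable_compose2[OF f(1)]
        computable_intros)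
  then obtain h where h: "computable h"
    "\<And>z. W (h z) = {k. \<exists>j. j \<in> W (psnd z) \<and> k \<in> W (f (pfst z) j)}"
    by (rule semidecidable_W_index) (rule that)
  have "eff_open_set B (h (prod_encode (i, e))) = (\<Union>j\<in>W e. B i \<inter> B j)" for i e
    unfolding f(2) by (auto simp: eff_open_set_def h(2))
  then have "eff_open_set B (h (prod_encode (i, e))) = B i \<inter> eff_open_set B e" for i e
    unfolding eff_open_set_def Int_UN_distrib .
  with h(1) show ?thesis by (rule that)
qed

lemma uniformly_eff_open_finite_intersection:
  assumes "effective_topological_space X B"
  shows "uniformly_eff_open B
    (\<lambda>c. {x \<in> topspace X. listed_set (list_decode c) \<subseteq> canonical_embedding B x})"
proof -
  obtain h where h: "computable h"
    "\<And>i e. eff_open_set B (h (prod_encode (i, e))) = B i \<inter> eff_open_set B e"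
    using computable_intersection_index[OF assms] by blast
  have "ce UNIV"
    unfolding ce_iff_semidecidable by (simp add: semidecidable_if_decidable decidable_const)
  then obtain e\<^sub>0 where "W e\<^sub>0 = UNIV" unfolding ce_def by metis
  then have top: "eff_open_set B e\<^sub>0 = topspace X"
    by (simp add: eff_open_set_def topspace_eq_UN_basis[OF assms])
  define intersect where "intersect v e = (if v = 0 then e else h (prod_encode (v - 1, e)))" for v e
  have "computable (\<lambda>z. intersect (pfst z) (psnd z))"
    unfolding intersect_def by (intro computable_intros computable_compose[OF h(1)])
  then have "computable (\<lambda>c. fold intersect (list_decode c) e\<^sub>0)"
    by (intro computable_fold_on[where I = "\<lambda>_. True"] computable_intros)
      (simp_all add: computable_on_UNIV)
  moreover have "eff_open_set B (fold intersect s e) =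
      {x \<in> eff_open_set B e. listed_set s \<subseteq> canonical_embedding B x}" for s e
  proof (induction s arbitrary: e)
    case (Cons v s)
    then show ?case
      by (cases v) (auto simp: intersect_def h(2) listed_set_def canonical_embedding_def)
  qed (simp add: listed_set_def)
  ultimately show ?thesis
    unfolding uniformly_eff_open_def
    by (intro exI[of _ "\<lambda>c. fold intersect (list_decode c) e\<^sub>0"]) (simp add: top)
qed

lemma effective_quasi_Polish_image:
  assumes "effective_quasi_Polish Y C" and image: "\<phi> ` topspace Y = topspace X"
    and preimages: "uniformly_eff_open C (\<lambda>i. {y \<in> topspace Y. \<phi> y \<in> B i})"
    and images: "uniformly_eff_open B (\<lambda>n. \<phi> ` C n)"
  shows "effective_quasi_Polish X B"
proof (cases "topspace Y = {}")
  case True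
  then show ?thesis using image by (simp add: effective_quasi_Polish_def)
next
  case False
  then obtain g :: "(nat \<Rightarrow> nat) \<Rightarrow> _" where g: "range g = topspace Y"
    "uniformly_eff_open baire_basis (\<lambda>i. g -` C i)"
    "uniformly_eff_open C (\<lambda>n. g ` cylinder (list_decode n))"
    using assms(1) unfolding effective_quasi_Polish_def by blast
  obtain P where P: "semidecidable2 P" "\<And>i. {y \<in> topspace Y. \<phi> y \<in> B i} = (\<Union>k\<in>{k. P i k}. C k)"
    using uniformly_eff_openE[OF preimages] by blast
  obtain Q where Q: "semidecidable2 Q" "\<And>n. g ` cylinder (list_decode n) = (\<Union>k\<in>{k. Q n k}. C k)"
    using uniformly_eff_openE[OF g(3)] by blast
  have "range (\<lambda>q. \<phi> (g q)) = topspace X"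
    using g(1) image by (simp add: image_image[symmetric, of \<phi> g])
  moreover have "uniformly_eff_open baire_basis (\<lambda>i. (\<lambda>q. \<phi> (g q)) -` B i)"
  proof -
    have "(\<lambda>q. \<phi> (g q)) -` B i = g -` {y \<in> topspace Y. \<phi> y \<in> B i}" for i
      using g(1) by auto
    then show ?thesis
      using uniformly_eff_open_UN[OF g(2) P(1)] by (simp add: P(2) vimage_UN)
  qed
  moreover have "uniformly_eff_open B (\<lambda>n. (\<lambda>q. \<phi> (g q)) ` cylinder (list_decode n))"
    using uniformly_eff_open_UN[OF images Q(1)]
    by (simp add: image_image[symmetric, of \<phi> g] Q(2) image_UN)
  ultimately show ?thesis unfolding effective_quasi_Polish_def by blast
qed

lemma image_standard_representation_cylinder:
  fixes X B defines "\<rho> \<equiv> standard_representation X B"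
  assumes "effective_topological_space X B"
  shows "(\<lambda>p. the (\<rho> p)) ` (cylinder s \<inter> dom \<rho>) =
    {x \<in> topspace X. listed_set s \<subseteq> canonical_embedding B x}"
proof -
  have "(\<lambda>p. the (\<rho> p)) ` (cylinder s \<inter> dom \<rho>) = {x. \<exists>p\<in>cylinder s. \<rho> p = Some x}"
    by (force simp: dom_def)
  then show ?thesis unfolding \<rho>_def ex_cylinder_standard_representation_iff[OF assms(2)] .
qed

lemma uniformly_eff_open_standard_representation_preimage:
  fixes X B defines "\<rho> \<equiv> standard_representation X B"
  assumes "effective_topological_space X B"
  shows "uniformly_eff_open (\<lambda>c. baire_basis c \<inter> dom \<rho>) (\<lambda>i. {p \<in> dom \<rho>. the (\<rho> p) \<in> B i})"
proof (rule uniformly_eff_openI)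
  show "semidecidable2 (\<lambda>i c. Suc i \<in> set (list_decode c))"
    by (intro semidecidable_if_decidable computable_intros)
  have "the (\<rho> p) \<in> B i \<longleftrightarrow> (\<exists>c. p \<in> cylinder (list_decode c) \<and> Suc i \<in> set (list_decode c))"
    if p: "p \<in> dom \<rho>" for p i
  proof -
    obtain x where x: "\<rho> p = Some x" using p by blast
    then have "enumerated_set p = {n. x \<in> B n}"
      by (simp add: \<rho>_def standard_representation_eq_Some_iff[OF assms(2)] canonical_embedding_def)
    then have "the (\<rho> p) \<in> B i \<longleftrightarrow> i \<in> enumerated_set p" using x by simp
    also have "\<dots> \<longleftrightarrow> (\<exists>c. p \<in> cylinder (list_decode c) \<and> Suc i \<in> set (list_decode c))"
      using ex_list_decode[of "\<lambda>s. p \<in> cylinder s \<and> Suc i \<in> set s"]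
      by (simp add: mem_enumerated_set_iff listed_set_def)
    finally show ?thesis .
  qed
  then show "{p \<in> dom \<rho>. the (\<rho> p) \<in> B i} =
      (\<Union>c\<in>{c. Suc i \<in> set (list_decode c)}. baire_basis c \<inter> dom \<rho>)" for i
    by (auto simp: baire_basis_def)
qed

lemma effective_quasi_Polish_if_dom_standard_representation:
  assumes X: "effective_topological_space X B"
    and dom: "effective_quasi_Polish (top_of_set (dom (standard_representation X B)))
      (\<lambda>c. baire_basis c \<inter> dom (standard_representation X B))"
  shows "effective_quasi_Polish X B"
proof (rule effective_quasi_Polish_image[OF dom])
  let ?\<rho> = "standard_representation X B"
  let ?\<phi> = "\<lambda>p. the (?\<rho> p)"
  note image = image_standard_representation_cylinder[OF X]
  from image[of "[]"] show "?\<phi> ` topspace (top_of_set (dom ?\<rho>)) = topspace X"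
    by (simp add: listed_set_def)
  show "uniformly_eff_open (\<lambda>c. baire_basis c \<inter> dom ?\<rho>)
      (\<lambda>i. {p \<in> topspace (top_of_set (dom ?\<rho>)). ?\<phi> p \<in> B i})"
    using uniformly_eff_open_standard_representation_preimage[OF X] by simp
  show "uniformly_eff_open B (\<lambda>c. ?\<phi> ` (baire_basis c \<inter> dom ?\<rho>))"
    using uniformly_eff_open_finite_intersection[OF X] by (simp add: baire_basis_def image)
qed

section \<open>Computably admissible representations\<close>

lemma computably_admissibleE:
  assumes "computably_admissible X B \<delta>"
  obtains c d where
    "\<And>p x. standard_representation X B p = Some x \<Longrightarrow> \<exists>q. \<delta> q = Some x \<and> computes c p q"
    "\<And>q x. \<delta> q = Some x \<Longrightarrow> \<exists>r. standard_representation X B r = Some x \<and> computes d q r"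
proof -
  let ?\<rho> = "standard_representation X B"
  obtain F G where F: "partial_computable F" "?\<rho> = \<delta> \<circ>\<^sub>m F"
    and G: "partial_computable G" "\<delta> = ?\<rho> \<circ>\<^sub>m G"
    using assms unfolding computably_admissible_def by blast
  obtain c where c: "\<And>p q. F p = Some q \<Longrightarrow> computes c p q"
    using F(1) unfolding partial_computable_def computes_def by blast
  obtain d where d: "\<And>q r. G q = Some r \<Longrightarrow> computes d q r"
    using G(1) unfolding partial_computable_def computes_def by blast
  have "\<exists>q. F p = Some q \<and> \<delta> q = Some x" if "?\<rho> p = Some x" for p x
    using that unfolding F(2) by (auto simp: map_comp_Some_iff)
  moreover have "\<exists>r. G q = Some r \<and> ?\<rho> r = Some x" if "\<delta> q = Some x" for q x
    using that unfolding G(2) by (auto simp: map_comp_Some_iff)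
  ultimately show ?thesis using c d by (intro that[of c d]) blast+
qed

lemma dom_standard_representation_eq:
  assumes X: "effective_topological_space X B"
    and c: "\<And>p x. standard_representation X B p = Some x \<Longrightarrow> \<exists>q. \<delta> q = Some x \<and> computes c p q"
    and d: "\<And>q x. \<delta> q = Some x \<Longrightarrow> \<exists>r. standard_representation X B r = Some x \<and> computes d q r"
  shows "dom (standard_representation X B) = {p. \<exists>q\<in>dom \<delta>. computes c p q} \<inter>
    {p. \<exists>r. computes (subst_query c d) p r \<and> enumerated_set r = enumerated_set p}"
    (is "dom ?\<rho> = ?P \<inter> ?E")
proof -
  note \<rho> = standard_representation_eq_Some_iff[OF X]
  have "p \<in> ?P \<inter> ?E" if "p \<in> dom ?\<rho>" for p
  proof -
    obtain x where x: "?\<rho> p = Some x" using \<open>p \<in> dom ?\<rho>\<close> by blast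
    obtain q where q: "\<delta> q = Some x" "computes c p q" using c[OF x] by blast
    obtain r where r: "?\<rho> r = Some x" "computes d q r" using d[OF q(1)] by blast
    have "computes (subst_query c d) p r" using q(2) r(2) by (rule computes_subst_query)
    moreover have "enumerated_set r = enumerated_set p" using r(1) x by (simp add: \<rho>)
    ultimately show ?thesis using q by blast
  qed
  moreover have "p \<in> dom ?\<rho>" if "p \<in> ?P \<inter> ?E" for p
  proof -
    obtain q x where q: "\<delta> q = Some x" "computes c p q" using \<open>p \<in> ?P \<inter> ?E\<close> by blast
    obtain r where r: "?\<rho> r = Some x" "computes d q r" using d[OF q(1)] by blast
    have "computes (subst_query c d) p r" using q(2) r(2) by (rule computes_subst_query)
    then have "enumerated_set r = enumerated_set p"
      using \<open>p \<in> ?P \<inter> ?E\<close> computes_functional by blast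
    then have "?\<rho> p = Some x" using r(1) by (simp add: \<rho>)
    then show ?thesis by blast
  qed
  ultimately show ?thesis by blast
qed

lemma Pi02_dom_standard_representation:
  assumes "effective_topological_space X B" "computably_admissible X B \<delta>" "Pi02 (dom \<delta>)"
  shows "Pi02 (dom (standard_representation X B))"
proof -
  obtain c d where
    "\<And>p x. standard_representation X B p = Some x \<Longrightarrow> \<exists>q. \<delta> q = Some x \<and> computes c p q"
    "\<And>q x. \<delta> q = Some x \<Longrightarrow> \<exists>r. standard_representation X B r = Some x \<and> computes d q r"
    using computably_admissibleE[OF assms(2)] by blast
  from dom_standard_representation_eq[OF assms(1) this] show ?thesis
    by (simp only:) (intro Pi02_Int Pi02_preimage Pi02_enumerated_set_fixed assms(3))
qed

lemma computably_overt_dom_standard_representation: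
  assumes X: "effective_topological_space X B" and \<delta>: "is_representation X \<delta>"
    and adm: "computably_admissible X B \<delta>" and overt: "computably_overt (dom \<delta>)"
  shows "computably_overt (dom (standard_representation X B))"
proof -
  let ?\<rho> = "standard_representation X B"
  obtain d where d: "\<And>q x. \<delta> q = Some x \<Longrightarrow> \<exists>r. ?\<rho> r = Some x \<and> computes d q r"
    by (rule computably_admissibleE[OF adm]) (rule that)
  define lists where "lists q s \<longleftrightarrow> (\<forall>i<length s. nth_default 0 s i = 0 \<or>
    (\<exists>j. evals q d j (nth_default 0 s i)))" for q s
  have lists_iff: "lists q s \<longleftrightarrow> listed_set s \<subseteq> canonical_embedding B x"
    if q: "\<delta> q = Some x" for q x s
  proof -
    obtain r where r: "?\<rho> r = Some x" "computes d q r" using d[OF q] by blast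
    have "lists q s \<longleftrightarrow> listed_set s \<subseteq> enumerated_set r"
      unfolding lists_def listed_set_subset_enumerated_set_iff
      by (simp add: evals_iff_if_computes[OF r(2)])
    then show ?thesis using r(1) by (simp add: standard_representation_eq_Some_iff[OF X])
  qed
  have "cylinder s \<inter> dom ?\<rho> \<noteq> {} \<longleftrightarrow> (\<exists>q\<in>dom \<delta>. lists q s)" for s
  proof -
    have "cylinder s \<inter> dom ?\<rho> \<noteq> {} \<longleftrightarrow> (\<exists>x. \<exists>p\<in>cylinder s. ?\<rho> p = Some x)" by blast
    also have "\<dots> \<longleftrightarrow> (\<exists>x\<in>ran \<delta>. listed_set s \<subseteq> canonical_embedding B x)"
      using \<delta> unfolding ex_cylinder_standard_representation_iff[OF X] is_representation_def by blast
    also have "\<dots> \<longleftrightarrow> (\<exists>q\<in>dom \<delta>. lists q s)"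
      using lists_iff unfolding ran_def dom_def by fast
    finally show ?thesis .
  qed
  moreover have "oracle_semidecidable (\<lambda>q c. lists q (list_decode c))"
    unfolding lists_def
    by (intro oracle_semidecidable_intros oracle_semidecidable_if_semidecidable
        semidecidable_if_decidable computable_intros)
  ultimately show ?thesis
    using semidecidable_bex_overt[OF overt] unfolding computably_overt_iff by simp
qed

theorem theorem3:
  fixes X :: "'a topology" and B :: "nat \<Rightarrow> 'a set"
    and \<delta> :: "(nat \<Rightarrow> nat) \<rightharpoonup> 'a"
  assumes "effective_topological_space X B"
    and "is_representation X \<delta>"
    and "computably_admissible X B \<delta>"
    and "computably_overt (dom \<delta>)"
    and "Pi02 (dom \<delta>)"
  shows "effective_quasi_Polish X B"
proof -
  let ?D = "dom (standard_representation X B)"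
  have "computably_overt ?D"
    using assms(1-4) by (rule computably_overt_dom_standard_representation)
  moreover have "Pi02 ?D"
    using assms(1,3,5) by (rule Pi02_dom_standard_representation)
  ultimately have "effective_quasi_Polish (top_of_set ?D) (\<lambda>i. baire_basis i \<inter> ?D)"
    by (rule effective_quasi_Polish_if_overt_Pi02)
  with assms(1) show ?thesis by (rule effective_quasi_Polish_if_dom_standard_representation)
qed

end
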